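(* Let $A\in\mathbb{C}^{2\times2}$ be non-singular and let $P=\begin{pmatrix}1&0\\0&0\end{pmatrix}$. The adjoint of $AD$ is $$(AD)^*f=-A^*f'',$$ for $f\in W^{2,2}$ subject to the boundary conditions $$\hat Pf(0)=\hat Pf(1)=0,\qquad (I-\hat P)f'(0)=(I-\hat P)f'(1)=0,$$ where $\hat P=\hat P^2$ is the rank one (not necessarily orthogonal) projection on $\mathbb{C}^2$ such that $$\mathrm{Ran}(\hat P)=\mathrm{Ran}(A(I-P))^\perp,\qquad \mathrm{Ran}(I-\hat P)=\mathrm{Ran}(AP)^\perp.$$
   Context: Let $W^{2,2}$ be the Sobolev space of all $f\in L^2(0,1)\otimes\mathbb{C}^2$ whose generalized derivative $f''$ lies in $L^2(0,1)\otimes\mathbb{C}^2$, and write $f=\begin{pmatrix}\phi\\ \gamma\end{pmatrix}$. The operator $D$ acts on $L^2(0,1)\otimes\mathbb{C}^2$ by $Df=-f''$ with domain $\mathrm{Dom}(D)=\{f\in W^{2,2}:\phi(0)=\phi(1)=0,\ \gamma'(0)=\gamma'(1)=0\}$. $AD$ is the operator $f\mapsto -Af''$ with domain $\mathrm{Dom}(D)$. $\mathrm{Ran}$ denotes the range. *)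

theory Defs
  imports "HOL-Analysis.Analysis"
begin

definition herm :: "complex^2 \<Rightarrow> complex^2 \<Rightarrow> complex" where
  "herm u v = (\<Sum>i\<in>UNIV. u $ i * cnj (v $ i))"

text \<open>The library has \<open>orthogonal_comp\<close> only for the real inner product.\<close>

definition herm_compl :: "(complex^2) set \<Rightarrow> (complex^2) set" where
  "herm_compl S = {v. \<forall>w\<in>S. herm v w = 0}"

definition adj_mat :: "complex^2^2 \<Rightarrow> complex^2^2" where
  "adj_mat A = transpose (map_matrix cnj A)"

definition ran :: "complex^2^2 \<Rightarrow> (complex^2) set" where
  "ran A = range (\<lambda>v. A *v v)"

definition projP :: "complex^2^2" where
  "projP = vector [vector [1, 0], vector [0, 0]]"

definition is_hat_proj :: "complex^2^2 \<Rightarrow> complex^2^2 \<Rightarrow> bool" where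
  "is_hat_proj A Q \<longleftrightarrow>
     Q ** Q = Q \<and> rank Q = 1 \<and>
     ran Q = herm_compl (ran (A ** (mat 1 - projP))) \<and>
     ran (mat 1 - Q) = herm_compl (ran (A ** projP))"

abbreviation M01 :: "real measure" where
  "M01 \<equiv> lebesgue_on {0<..<1}"

definition sq_integrable :: "(real \<Rightarrow> complex^2) \<Rightarrow> bool" where
  "sq_integrable f \<longleftrightarrow> f \<in> borel_measurable M01 \<and> integrable M01 (\<lambda>x. (norm (f x))\<^sup>2)"

definition l2rel :: "(real \<Rightarrow> complex^2) \<Rightarrow> (real \<Rightarrow> complex^2) \<Rightarrow> bool" where
  "l2rel f g \<longleftrightarrow> sq_integrable f \<and> sq_integrable g \<and> (AE x in M01. f x = g x)"

quotient_type l2 = "real \<Rightarrow> complex^2" / partial: l2rel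
proof (rule part_equivpI)
  show "\<exists>f. l2rel f f"
    by (rule exI[of _ "\<lambda>_. 0"]) (simp add: l2rel_def sq_integrable_def)
  show "symp l2rel"
  proof (rule sympI)
    fix f g assume fg: "l2rel f g"
    then have "AE x in M01. f x = g x" by (simp add: l2rel_def)
    then have "AE x in M01. g x = f x" by eventually_elim simp
    with fg show "l2rel g f" by (simp add: l2rel_def)
  qed
  show "transp l2rel"
  proof (rule transpI)
    fix f g h assume fg: "l2rel f g" and gh: "l2rel g h"
    from fg have "AE x in M01. f x = g x" by (simp add: l2rel_def)
    moreover from gh have "AE x in M01. g x = h x" by (simp add: l2rel_def)
    ultimately have "AE x in M01. f x = h x" by eventually_elim simp
    with fg gh show "l2rel f h" by (simp add: l2rel_def)
  qed
qed

lemma measurable_herm: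
  assumes "f \<in> borel_measurable M" "g \<in> borel_measurable M"
  shows "(\<lambda>x. herm (f x) (g x)) \<in> borel_measurable M"
proof -
  have "continuous_on UNIV (\<lambda>p::(complex^2) \<times> (complex^2). herm (fst p) (snd p))"
    unfolding herm_def by (intro continuous_intros)
  from borel_measurable_continuous_on[OF this borel_measurable_Pair[OF assms]]
  show ?thesis by simp
qed

lift_definition l2_inner :: "l2 \<Rightarrow> l2 \<Rightarrow> complex" is
  "\<lambda>f g. integral\<^sup>L M01 (\<lambda>x. herm (f x) (g x))"
proof -
  fix f f' g g' assume ff: "l2rel f f'" and gg: "l2rel g g'"
  have "AE x in M01. f x = f' x" "AE x in M01. g x = g' x"
    using ff gg by (simp_all add: l2rel_def)
  then have "AE x in M01. herm (f x) (g x) = herm (f' x) (g' x)"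
    by eventually_elim simp
  then show "integral\<^sup>L M01 (\<lambda>x. herm (f x) (g x)) = integral\<^sup>L M01 (\<lambda>x. herm (f' x) (g' x))"
    using ff gg by (intro integral_cong_AE measurable_herm) (simp_all add: l2rel_def sq_integrable_def)
qed

lemma norm_matrix_vector_mult_bound:
  fixes A :: "complex^2^2"
  obtains K where "\<And>v. norm (A *v v) \<le> K * norm v"
proof -
  have "bounded_linear (\<lambda>v. A *v v)"
    by (intro linear_conv_bounded_linear[THEN iffD1] linearI)
       (simp_all add: matrix_vector_right_distrib vec_eq_iff matrix_vector_mult_def scaleR_right.sum
         distrib_left sum.distrib)
  then obtain K where "\<And>v. norm (A *v v) \<le> norm v * K"
    using bounded_linear.bounded by blast
  then show ?thesis
    by (intro that[of K]) (simp add: mult.commute)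
qed

lemma sq_integrable_matrix:
  assumes "sq_integrable f"
  shows "sq_integrable (\<lambda>x. A *v f x)"
proof -
  obtain K where K: "norm (A *v v) \<le> K * norm v" for v
    using norm_matrix_vector_mult_bound[of A] by blast
  have cont: "continuous_on UNIV (\<lambda>v::complex^2. A *v v)"
    unfolding matrix_vector_mult_def by (intro continuous_intros)
  have meas: "(\<lambda>x. A *v f x) \<in> borel_measurable M01"
    using assms by (intro borel_measurable_continuous_on[OF cont]) (simp add: sq_integrable_def)
  have "integrable M01 (\<lambda>x. (norm (A *v f x))\<^sup>2)"
  proof (rule Bochner_Integration.integrable_bound)
    show "integrable M01 (\<lambda>x. K\<^sup>2 * (norm (f x))\<^sup>2)"
      using assms by (simp add: sq_integrable_def)
    show "(\<lambda>x. (norm (A *v f x))\<^sup>2) \<in> borel_measurable M01"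
      using meas by measurable
    show "AE x in M01. norm ((norm (A *v f x))\<^sup>2) \<le> norm (K\<^sup>2 * (norm (f x))\<^sup>2)"
      using power_mono[OF K norm_ge_zero, of _ 2] by (auto simp: power_mult_distrib)
  qed
  with meas show ?thesis by (simp add: sq_integrable_def)
qed

lift_definition l2_matrix :: "complex^2^2 \<Rightarrow> l2 \<Rightarrow> l2" is
  "\<lambda>A f x. A *v f x"
proof -
  fix A :: "complex^2^2" and f g assume fg: "l2rel f g"
  then have "AE x in M01. f x = g x" by (simp add: l2rel_def)
  then have "AE x in M01. A *v f x = A *v g x" by eventually_elim simp
  with fg show "l2rel (\<lambda>x. A *v f x) (\<lambda>x. A *v g x)"
    by (simp add: l2rel_def sq_integrable_matrix)
qed

definition test_function :: "(real \<Rightarrow> real) \<Rightarrow> bool" where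
  "test_function \<theta> \<longleftrightarrow>
     (\<forall>k. (deriv ^^ k) \<theta> differentiable_on UNIV) \<and>
     (\<exists>a b. 0 < a \<and> b < 1 \<and> (\<forall>x. x \<notin> {a..b} \<longrightarrow> \<theta> x = 0))"

lemma measurable_test_deriv:
  assumes "test_function \<theta>"
  shows "(deriv ^^ k) \<theta> \<in> borel_measurable M01"
proof -
  have "continuous_on {0<..<1} ((deriv ^^ k) \<theta>)"
    using assms differentiable_imp_continuous_on continuous_on_subset
    unfolding test_function_def by blast
  then show ?thesis
    by (rule continuous_imp_measurable_on_sets_lebesgue) simp
qed

lift_definition has_gen_deriv2 :: "l2 \<Rightarrow> l2 \<Rightarrow> bool" is
  "\<lambda>f g. \<forall>\<theta>. test_function \<theta> \<longrightarrow>
     integral\<^sup>L M01 (\<lambda>x. (deriv ^^ 2) \<theta> x *\<^sub>R f x) = integral\<^sup>L M01 (\<lambda>x. \<theta> x *\<^sub>R g x)"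
proof -
  fix f f' g g' :: "real \<Rightarrow> complex^2"
  assume "l2rel f f'" "l2rel g g'"
  then have f: "f \<in> borel_measurable M01" "f' \<in> borel_measurable M01" "AE x in M01. f x = f' x"
    and g: "g \<in> borel_measurable M01" "g' \<in> borel_measurable M01" "AE x in M01. g x = g' x"
    by (auto simp: l2rel_def sq_integrable_def)
  have "integral\<^sup>L M01 (\<lambda>x. (deriv ^^ 2) \<theta> x *\<^sub>R f x) = integral\<^sup>L M01 (\<lambda>x. (deriv ^^ 2) \<theta> x *\<^sub>R f' x)"
    if "test_function \<theta>" for \<theta>
  proof (rule integral_cong_AE)
    show "AE x in M01. (deriv ^^ 2) \<theta> x *\<^sub>R f x = (deriv ^^ 2) \<theta> x *\<^sub>R f' x"
      using f(3) by eventually_elim simp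
  qed (intro borel_measurable_scaleR measurable_test_deriv f that)+
  moreover have "integral\<^sup>L M01 (\<lambda>x. \<theta> x *\<^sub>R g x) = integral\<^sup>L M01 (\<lambda>x. \<theta> x *\<^sub>R g' x)"
    if "test_function \<theta>" for \<theta>
  proof (rule integral_cong_AE)
    have \<theta>: "\<theta> \<in> borel_measurable M01"
      using measurable_test_deriv[OF that, of 0] by simp
    show "(\<lambda>x. \<theta> x *\<^sub>R g x) \<in> borel_measurable M01" "(\<lambda>x. \<theta> x *\<^sub>R g' x) \<in> borel_measurable M01"
      by (intro borel_measurable_scaleR \<theta> g)+
    show "AE x in M01. \<theta> x *\<^sub>R g x = \<theta> x *\<^sub>R g' x"
      using g(3) by eventually_elim simp
  qed
  ultimately show "(\<forall>\<theta>. test_function \<theta> \<longrightarrow>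
      integral\<^sup>L M01 (\<lambda>x. (deriv ^^ 2) \<theta> x *\<^sub>R f x) = integral\<^sup>L M01 (\<lambda>x. \<theta> x *\<^sub>R g x)) =
    (\<forall>\<theta>. test_function \<theta> \<longrightarrow>
      integral\<^sup>L M01 (\<lambda>x. (deriv ^^ 2) \<theta> x *\<^sub>R f' x) = integral\<^sup>L M01 (\<lambda>x. \<theta> x *\<^sub>R g' x))"
    by simp
qed

definition W22 :: "l2 set" where
  "W22 = {f. \<exists>g. has_gen_deriv2 f g}"

definition gen_deriv2 :: "l2 \<Rightarrow> l2" where
  "gen_deriv2 f = (THE g. has_gen_deriv2 f g)"

text \<open>
  Point values of \<open>f\<close> and \<open>f'\<close> at the endpoints are those of the continuously differentiable
  function on the closed interval that represents \<open>f\<close>. Every element of \<open>W22\<close> has such a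
  representative, and its values on the closed interval, which are all that is used below,
  are determined by \<open>f\<close>.
\<close>

definition C1_on_unit :: "(real \<Rightarrow> complex^2) \<Rightarrow> bool" where
  "C1_on_unit u \<longleftrightarrow>
     (\<exists>u'. (\<forall>x\<in>{0..1}. (u has_vector_derivative u' x) (at x within {0..1})) \<and>
           continuous_on {0..1} u')"

lift_definition represents :: "(real \<Rightarrow> complex^2) \<Rightarrow> l2 \<Rightarrow> bool" is
  "\<lambda>u f. AE x in M01. u x = f x"
proof -
  fix u f g :: "real \<Rightarrow> complex^2" assume "l2rel f g"
  then have fg: "AE x in M01. f x = g x" by (simp add: l2rel_def)
  show "(AE x in M01. u x = f x) = (AE x in M01. u x = g x)"
  proof
    assume "AE x in M01. u x = f x"
    with fg show "AE x in M01. u x = g x" by eventually_elim simp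
  next
    assume "AE x in M01. u x = g x"
    with fg show "AE x in M01. u x = f x" by eventually_elim simp
  qed
qed

definition C1_rep :: "l2 \<Rightarrow> real \<Rightarrow> complex^2" where
  "C1_rep f = (SOME u. C1_on_unit u \<and> represents u f)"

definition point_val :: "l2 \<Rightarrow> real \<Rightarrow> complex^2" where
  "point_val f x = C1_rep f x"

definition point_deriv :: "l2 \<Rightarrow> real \<Rightarrow> complex^2" where
  "point_deriv f x = vector_derivative (C1_rep f) (at x within {0..1})"

text \<open>
  An unbounded operator is a partial map, so that equality of operators includes equality of
  their domains. The element \<open>h\<close> below is unique when \<open>T\<close> is densely defined.
\<close>

definition op_adjoint :: "(l2 \<rightharpoonup> l2) \<Rightarrow> (l2 \<rightharpoonup> l2)" where
  "op_adjoint T = (\<lambda>g.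
     if \<exists>h. \<forall>f\<in>dom T. l2_inner (the (T f)) g = l2_inner f h
     then Some (THE h. \<forall>f\<in>dom T. l2_inner (the (T f)) g = l2_inner f h)
     else None)"

definition DomD :: "l2 set" where
  "DomD = {f \<in> W22. point_val f 0 $ 1 = 0 \<and> point_val f 1 $ 1 = 0 \<and>
                    point_deriv f 0 $ 2 = 0 \<and> point_deriv f 1 $ 2 = 0}"

definition opAD :: "complex^2^2 \<Rightarrow> (l2 \<rightharpoonup> l2)" where
  "opAD A = (\<lambda>f. Some (l2_matrix (- A) (gen_deriv2 f))) |` DomD"

end

(* Write B for the adjoint matrix of A. Since <-A f'', g> = <f'', -B g>, the adjoint of AD is governed
   by the self-adjointness of f |-> f'' on Dom(D). Testing against multiples of test functions shows that
   w = -B g lies in W22; testing against cubic polynomials then shows that w satisfies the boundary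
   conditions of Dom(D). The converse is integration by parts.
   A vector x is orthogonal to Ran(A P) iff (B x)_1 = 0, and to Ran(A (I - P)) iff (B x)_2 = 0; hence
   the projection is B^-1 P B.
   Weak second derivatives are identified with iterated indefinite integrals by the du Bois-Reymond
   lemma, and integration by parts for indefinite integrals is Fubini on the triangle t <= x. *)

theory Submission
  imports Defs
begin

section \<open>Smooth functions and test functions\<close>

text \<open>The definitions offer only a distributional second derivative and, for boundary values,
  an arbitrary choice of a C1 representative. Neither can be computed with, so an element of
  \<open>W22\<close> is handled through a triple \<open>u\<close>, \<open>v\<close>,
  \<open>g\<close>: \<open>u\<close> represents it, \<open>u\<close> is an indefinite integral of
  \<open>v\<close>, and \<open>v\<close> is one of the second derivative \<open>g\<close>. The weak
  formulation supplies no first derivative to start from, hence a du Bois-Reymond lemma of second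
  order. Cubics suit the boundary because the values and slopes of a cubic at 0 and 1 can be
  prescribed freely, so the boundary values of \<open>w\<close> can be separated from one another.
  The value of the adjoint is unique because its defining relation forces it to be the weak second
  derivative of \<open>w\<close>, and weak derivatives are unique. Non-singularity of
  \<open>A\<close> enters twice: it yields the projection, and it lets \<open>g\<close> be recovered
  from \<open>w\<close>, so that \<open>w\<close> in \<open>W22\<close> gives \<open>g\<close> in
  \<open>W22\<close>.\<close>

definition smooth :: "(real \<Rightarrow> real) \<Rightarrow> bool" where
  "smooth f \<longleftrightarrow> (\<forall>k. (deriv ^^ k) f differentiable_on UNIV)"

text \<open>Higher derivatives of a product or a composite have no convenient closed form. Bounding
  the order and quantifying over all functions allows an induction in which each step needs only the
  rule for the first derivative and closure at order \<open>n\<close>.\<close>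

definition differentiable_upto :: "nat \<Rightarrow> (real \<Rightarrow> real) \<Rightarrow> bool" where
  "differentiable_upto n f \<longleftrightarrow> (\<forall>k\<le>n. (deriv ^^ k) f differentiable_on UNIV)"

lemma smooth_iff_differentiable_upto: "smooth f \<longleftrightarrow> (\<forall>n. differentiable_upto n f)"
  by (auto simp: smooth_def differentiable_upto_def)

lemma differentiable_upto_has_derivative:
  assumes "differentiable_upto n f"
  shows "(f has_real_derivative deriv f x) (at x)"
proof -
  have "f differentiable (at x)"
    using assms unfolding differentiable_upto_def
    by (metis differentiable_on_def UNIV_I funpow_0 le0)
  then show ?thesis
    by (simp add: DERIV_deriv_iff_real_differentiable)
qed

lemma differentiable_upto_0I:
  assumes "\<And>x. (f has_real_derivative f' x) (at x)"
  shows "differentiable_upto 0 f"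
  using assms by (auto simp: differentiable_upto_def differentiable_on_def real_differentiable_def)

lemma differentiable_upto_SucI:
  assumes "\<And>x. (f has_real_derivative f' x) (at x)" and "differentiable_upto n f'"
  shows "differentiable_upto (Suc n) f"
proof -
  have f': "deriv f = f'"
    using assms(1) by (auto intro: DERIV_imp_deriv)
  have 0: "f differentiable_on UNIV"
    using differentiable_upto_0I[OF assms(1)] by (simp add: differentiable_upto_def)
  have "(deriv ^^ k) f differentiable_on UNIV" if "k \<le> Suc n" for k
    using that 0 assms(2) by (cases k) (auto simp: differentiable_upto_def f' funpow_swap1)
  then show ?thesis
    by (simp add: differentiable_upto_def)
qed

lemma differentiable_upto_SucD:
  assumes "differentiable_upto (Suc n) f"
  shows "differentiable_upto n f" "differentiable_upto n (deriv f)"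
  using assms le_SucI unfolding differentiable_upto_def
  by (blast, metis Suc_le_mono comp_apply funpow_Suc_right)

lemma differentiable_upto_const: "differentiable_upto n (\<lambda>_. c)"
proof (induction n arbitrary: c)
  case 0
  show ?case by (rule differentiable_upto_0I[where f' = "\<lambda>_. 0"]) auto
next
  case (Suc n)
  show ?case by (rule differentiable_upto_SucI[where f' = "\<lambda>_. 0"]) (auto intro: Suc.IH)
qed

lemma differentiable_upto_add:
  assumes "differentiable_upto n f" "differentiable_upto n g"
  shows "differentiable_upto n (\<lambda>x. f x + g x)"
  using assms
proof (induction n arbitrary: f g)
  case 0
  show ?case
    by (rule differentiable_upto_0I[OF DERIV_add[OF 0[THEN differentiable_upto_has_derivative]]])
next
  case (Suc n)
  show ?case
    by (rule differentiable_upto_SucI[OF DERIV_add[OF Suc.prems[THEN differentiable_upto_has_derivative]]],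
        rule Suc.IH[OF Suc.prems[THEN differentiable_upto_SucD(2)]])
qed

lemma differentiable_upto_mult:
  assumes "differentiable_upto n f" "differentiable_upto n g"
  shows "differentiable_upto n (\<lambda>x. f x * g x)"
  using assms
proof (induction n arbitrary: f g)
  case 0
  show ?case
    by (rule differentiable_upto_0I[OF DERIV_mult[OF 0[THEN differentiable_upto_has_derivative]]])
next
  case (Suc n)
  note low = Suc.prems[THEN differentiable_upto_SucD(1)]
    and high = Suc.prems[THEN differentiable_upto_SucD(2)]
  show ?case
    by (rule differentiable_upto_SucI[OF DERIV_mult[OF Suc.prems[THEN differentiable_upto_has_derivative]]],
        rule differentiable_upto_add[OF Suc.IH[OF high(1) low(2)] Suc.IH[OF high(2) low(1)]])
qed

text \<open>The derivative contains exp (f x) again as a factor; the induction hypothesis covers it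
  because \<open>f\<close> is also differentiable to the lower order.\<close>

lemma differentiable_upto_exp:
  assumes "differentiable_upto n f"
  shows "differentiable_upto n (\<lambda>x. exp (f x))"
  using assms
proof (induction n)
  case 0
  show ?case
    by (rule differentiable_upto_0I[OF DERIV_chain'[OF 0[THEN differentiable_upto_has_derivative] DERIV_exp]])
next
  case (Suc n)
  note low = differentiable_upto_SucD(1)[OF Suc.prems]
    and high = differentiable_upto_SucD(2)[OF Suc.prems]
  show ?case
    by (rule differentiable_upto_SucI[OF DERIV_chain'[OF Suc.prems[THEN differentiable_upto_has_derivative] DERIV_exp]],
        rule differentiable_upto_mult[OF Suc.IH[OF low] high])
qed

lemma differentiable_upto_affine:
  assumes "differentiable_upto n f"
  shows "differentiable_upto n (\<lambda>x. f (a * x + b))"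
proof -
  have affine: "((\<lambda>x. a * x + b) has_real_derivative a) (at x)" for x
    by (auto intro!: derivative_eq_intros)
  show ?thesis
    using assms
  proof (induction n arbitrary: f)
    case 0
    have "((\<lambda>x. f (a * x + b)) has_real_derivative deriv f (a * x + b) * a) (at x)" for x
      by (rule DERIV_chain'[OF affine differentiable_upto_has_derivative[OF 0]])
    then show ?case
      by (rule differentiable_upto_0I)
  next
    case (Suc n)
    have "((\<lambda>x. f (a * x + b)) has_real_derivative deriv f (a * x + b) * a) (at x)" for x
      by (rule DERIV_chain'[OF affine differentiable_upto_has_derivative[OF Suc.prems]])
    then show ?case
      by (rule differentiable_upto_SucI)
         (rule differentiable_upto_mult[OF Suc.IH[OF differentiable_upto_SucD(2)[OF Suc.prems]] differentiable_upto_const])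
  qed
qed

lemma smooth_has_derivative: "smooth f \<Longrightarrow> (f has_real_derivative deriv f x) (at x)"
  using differentiable_upto_has_derivative smooth_iff_differentiable_upto by blast

lemma smooth_deriv: "smooth f \<Longrightarrow> smooth (deriv f)"
  using differentiable_upto_SucD(2) by (auto simp: smooth_iff_differentiable_upto)

text \<open>Lets an indefinite integral be recognised as smooth without computing its higher
  derivatives.\<close>

lemma smooth_antiderivative:
  assumes "\<And>x. (f has_real_derivative g x) (at x)" "smooth g"
  shows "smooth f"
  unfolding smooth_iff_differentiable_upto
proof
  fix n show "differentiable_upto n f"
    using assms differentiable_upto_0I[of f g] differentiable_upto_SucI[of f g]
    by (cases n) (auto simp: smooth_iff_differentiable_upto)
qed

lemma smooth_const: "smooth (\<lambda>_. c)"
  and smooth_add: "smooth f \<Longrightarrow> smooth g \<Longrightarrow> smooth (\<lambda>x. f x + g x)"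
  and smooth_mult: "smooth f \<Longrightarrow> smooth g \<Longrightarrow> smooth (\<lambda>x. f x * g x)"
  and smooth_exp: "smooth f \<Longrightarrow> smooth (\<lambda>x. exp (f x))"
  and smooth_affine: "smooth f \<Longrightarrow> smooth (\<lambda>x. f (a * x + b))"
  by (simp_all add: smooth_iff_differentiable_upto differentiable_upto_const differentiable_upto_add
      differentiable_upto_mult differentiable_upto_exp differentiable_upto_affine)

lemma smooth_continuous: "smooth f \<Longrightarrow> continuous_on S f"
  by (meson DERIV_isCont continuous_at_imp_continuous_on smooth_has_derivative)

text \<open>\<open>flat 0\<close> is the classical function exp (- 1 / x), extended by 0 to the
  left. The denominators are carried along because differentiation produces them: the family is
  closed under derivatives up to linear combinations, so one induction settles smoothness.\<close>

definition flat :: "nat \<Rightarrow> real \<Rightarrow> real" where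
  "flat n x = (if 0 < x then exp (- 1 / x) / x ^ n else 0)"

text \<open>The substitution y = 1 / x turns the right-hand limit into the decay of y ^ n / exp y at
  infinity.\<close>

lemma flat_tendsto_0: "(flat n \<longlongrightarrow> 0) (at 0)"
  unfolding filterlim_at_split
proof
  show "(flat n \<longlongrightarrow> 0) (at_left 0)"
    by (rule tendsto_eventually) (auto simp: flat_def eventually_at_left_field intro!: exI[of _ "-1"])
  have "((\<lambda>x::real. (inverse x) ^ n / exp (inverse x)) \<longlongrightarrow> 0) (at_right 0)"
    by (rule filterlim_compose[OF tendsto_power_div_exp_0 filterlim_inverse_at_top_right])
  moreover have "eventually (\<lambda>x. (inverse x) ^ n / exp (inverse x) = flat n x) (at_right 0)"
    by (auto simp: flat_def eventually_at_right_field field_simps exp_minus intro!: exI[of _ 1])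
  ultimately show "(flat n \<longlongrightarrow> 0) (at_right 0)"
    by (rule Lim_transform_eventually)
qed

lemma flat_has_derivative:
  "(flat n has_real_derivative flat (n + 2) x - real n * flat (n + 1) x) (at x)"
proof -
  consider "x < 0" | "x = 0" | "0 < x" by linarith
  then show ?thesis
  proof cases
    case 1
    have "((\<lambda>_. 0) has_real_derivative flat (n + 2) x - real n * flat (n + 1) x) (at x)"
      using 1 by (simp add: flat_def)
    then show ?thesis
      by (rule has_field_derivative_transform_within_open[where S = "{..<0}"])
         (use 1 in \<open>auto simp: flat_def\<close>)
  next
    case 2
    \<comment> \<open>The difference quotient at 0 is again a member of the family, so
      differentiability at 0 is the limit proved above. At h = 0 both sides are 0, division by zero
      being 0.\<close>
    have "(\<lambda>h. (flat n (0 + h) - flat n 0) / h) = flat (n + 1)"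
      by (auto simp: flat_def fun_eq_iff)
    then have "(flat n has_real_derivative 0) (at 0)"
      unfolding DERIV_def using flat_tendsto_0[of "n + 1"] by simp
    then show ?thesis
      using 2 by (simp add: flat_def)
  next
    case 3
    \<comment> \<open>Writing x ^ n / x instead of x ^ (n - 1) avoids truncated subtraction when n =
      0.\<close>
    have "((\<lambda>x. x ^ n) has_real_derivative real n * x ^ n / x) (at x)"
      using 3 DERIV_pow[of n x] by (cases n) auto
    moreover have "((\<lambda>x. exp (- 1 / x)) has_real_derivative exp (- 1 / x) / x\<^sup>2) (at x)"
      using 3 by (auto intro!: derivative_eq_intros simp: power2_eq_square)
    ultimately have "((\<lambda>x. exp (- 1 / x) / x ^ n) has_real_derivative
        (exp (- 1 / x) / x\<^sup>2 * x ^ n - exp (- 1 / x) * (real n * x ^ n / x)) / (x ^ n * x ^ n)) (at x)"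
      using 3 by (intro DERIV_divide) auto
    also have "(exp (- 1 / x) / x\<^sup>2 * x ^ n - exp (- 1 / x) * (real n * x ^ n / x)) / (x ^ n * x ^ n) =
        flat (n + 2) x - real n * flat (n + 1) x"
      using 3 by (simp add: flat_def field_simps power2_eq_square)
    finally have "((\<lambda>x. exp (- 1 / x) / x ^ n) has_real_derivative
        flat (n + 2) x - real n * flat (n + 1) x) (at x)" .
    then show ?thesis
      by (rule has_field_derivative_transform_within_open[where S = "{0<..}"])
         (use 3 in \<open>auto simp: flat_def\<close>)
  qed
qed

lemma smooth_flat: "smooth (flat n)"
proof -
  have "differentiable_upto k (flat n)" for k
  proof (induction k arbitrary: n)
    case 0
    show ?case by (rule differentiable_upto_0I, rule flat_has_derivative)
  next
    case (Suc k)
    have "differentiable_upto k (\<lambda>x. flat (n + 2) x + (- real n) * flat (n + 1) x)"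
      by (intro differentiable_upto_add differentiable_upto_mult differentiable_upto_const Suc.IH)
    then show ?case
      by (intro differentiable_upto_SucI[OF flat_has_derivative]) simp
  qed
  then show ?thesis
    by (simp add: smooth_iff_differentiable_upto)
qed

text \<open>As \<open>n\<close> grows these bumps converge pointwise to the indicator of the open interval \<open>(a, b)\<close>.\<close>

definition bump :: "real \<Rightarrow> real \<Rightarrow> nat \<Rightarrow> real \<Rightarrow> real" where
  "bump a b n x = 1 - exp (- real n * (flat 0 (x - a) * flat 0 (b - x)))"

lemma bump_nonneg: "0 \<le> bump a b n x"
  and bump_le_1: "bump a b n x \<le> 1"
  and bump_outside: "x \<notin> {a<..<b} \<Longrightarrow> bump a b n x = 0"
  and bump_inside: "x \<in> {a<..<b} \<Longrightarrow> 0 < n \<Longrightarrow> 0 < bump a b n x"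
  by (auto simp: bump_def flat_def)

lemma bump_tendsto: "(\<lambda>n. bump a b n x) \<longlonglongrightarrow> indicator {a<..<b} x"
proof (cases "x \<in> {a<..<b}")
  case True
  define c where "c = flat 0 (x - a) * flat 0 (b - x)"
  have "0 < c" using True by (simp add: c_def flat_def)
  then have "filterlim (\<lambda>n. - (real n * c)) at_bot sequentially"
    by (intro filterlim_uminus_at_top[THEN iffD1])
       (auto intro: filterlim_at_top_mult_tendsto_pos[OF tendsto_const] filterlim_real_sequentially)
  then have "(\<lambda>n. 1 - exp (- (real n * c))) \<longlonglongrightarrow> 1 - 0"
    by (intro tendsto_intros filterlim_compose[OF exp_at_bot])
  then show ?thesis
    using True by (simp add: bump_def c_def)
qed (simp add: bump_outside)

lemma smooth_bump: "smooth (bump a b n)"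
proof -
  have "smooth (\<lambda>x. 1 + (-1) * exp ((- real n) * (flat 0 (1 * x + (- a)) * flat 0 ((-1) * x + b))))"
    by (intro smooth_add smooth_mult smooth_exp smooth_const smooth_affine smooth_flat)
  then show ?thesis
    by (simp add: bump_def[abs_def])
qed

section \<open>Support and closure properties of test functions\<close>

lemma test_function_iff:
  "test_function \<theta> \<longleftrightarrow> smooth \<theta> \<and> (\<exists>a b. 0 < a \<and> a < b \<and> b < 1 \<and> (\<forall>x. x \<notin> {a..b} \<longrightarrow> \<theta> x = 0))"
    (is "_ \<longleftrightarrow> ?R")
proof
  assume "test_function \<theta>"
  then obtain a b where \<theta>: "smooth \<theta>" and ab: "0 < a" "b < 1" "\<And>x. x \<notin> {a..b} \<Longrightarrow> \<theta> x = 0"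
    unfolding test_function_def smooth_def by blast
  \<comment> \<open>The interval in \<open>test_function_def\<close> may be empty. Enlarging it by
    the points 1/4 and 1/2 gives one with a < b that still lies inside the open unit
    interval.\<close>
  have "0 < min a (1/4) \<and> min a (1/4) < max b (1/2) \<and> max b (1/2) < 1"
    "\<forall>x. x \<notin> {min a (1/4)..max b (1/2)} \<longrightarrow> \<theta> x = 0"
    using ab by (auto simp: min_def max_def split: if_splits)
  with \<theta> show ?R by blast
next
  assume ?R then show "test_function \<theta>"
    unfolding test_function_def smooth_def by blast
qed

lemma test_function_bump:
  assumes "0 < a" "a < b" "b < 1"
  shows "test_function (bump a b n)"
  unfolding test_function_iff
  using assms by (intro conjI smooth_bump exI[of _ a] exI[of _ b]) (auto simp: bump_outside)

lemma test_function_deriv: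
  assumes "test_function \<theta>"
  shows "test_function (deriv \<theta>)"
proof -
  obtain a b where \<theta>: "smooth \<theta>" and ab: "0 < a" "a < b" "b < 1" "\<And>x. x \<notin> {a..b} \<Longrightarrow> \<theta> x = 0"
    using assms unfolding test_function_iff by blast
  \<comment> \<open>The complement of the closed support interval is open, so \<theta> is locally
    constant there.\<close>
  have "deriv \<theta> x = 0" if "x \<notin> {a..b}" for x
  proof (rule DERIV_imp_deriv)
    show "(\<theta> has_real_derivative 0) (at x)"
      by (rule has_field_derivative_transform_within_open[of "\<lambda>_. 0" _ _ "- {a..b}"])
         (use that ab in auto)
  qed
  with \<theta> ab show ?thesis
    unfolding test_function_iff using smooth_deriv by blast
qed

lemma test_function_combine:
  assumes "test_function \<theta>" "test_function \<eta>"
  shows "test_function (\<lambda>x. \<theta> x + c * \<eta> x)"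
proof -
  obtain a b where \<theta>: "smooth \<theta>" and ab: "0 < a" "a < b" "b < 1" "\<And>x. x \<notin> {a..b} \<Longrightarrow> \<theta> x = 0"
    using assms unfolding test_function_iff by blast
  obtain a' b' where \<eta>: "smooth \<eta>" and ab': "0 < a'" "a' < b'" "b' < 1" "\<And>x. x \<notin> {a'..b'} \<Longrightarrow> \<eta> x = 0"
    using assms unfolding test_function_iff by blast
  show ?thesis
    unfolding test_function_iff
    by (intro conjI smooth_add smooth_mult smooth_const \<theta> \<eta>, rule exI[of _ "min a a'"], rule exI[of _ "max b b'"])
       (use ab ab' in \<open>auto simp: min_def max_def split: if_splits\<close>)
qed

section \<open>Indefinite integrals on the unit interval\<close>

lemma integrable_M01_imp_integrable_on:
  fixes f :: "real \<Rightarrow> 'a::euclidean_space"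
  assumes "integrable M01 f"
  shows "f integrable_on {0..1}"
  using integrable_on_lebesgue_on[OF assms] integrable_on_open_interval[of f "0::real" 1] by simp

lemma integrable_M01_indicator_Icc:
  fixes f :: "real \<Rightarrow> 'a::euclidean_space"
  assumes "integrable M01 f"
  shows "integrable M01 (\<lambda>t. indicator {a..b} t *\<^sub>R f t)"
proof -
  \<comment> \<open>\<open>{a..b}\<close> may leave the open unit interval and is then not a set of
    \<open>M01\<close>; its intersection with the space is.\<close>
  have "integrable M01 (\<lambda>t. indicator ({a..b} \<inter> {0<..<1}) t *\<^sub>R f t)"
    by (intro integrable_mult_indicator assms) (simp add: sets_restrict_space_iff)
  also have "?this \<longleftrightarrow> ?thesis"
    by (intro Bochner_Integration.integrable_cong) (auto simp: indicator_def)
  finally show ?thesis .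
qed

lemma integral_M01_Icc:
  fixes f :: "real \<Rightarrow> 'a::euclidean_space"
  assumes f: "integrable M01 f" and "0 \<le> a" "b \<le> 1"
  shows "(\<integral>t. indicator {a..b} t *\<^sub>R f t \<partial>M01) = integral {a..b} f"
proof -
  have "(\<integral>t. indicator {a..b} t *\<^sub>R f t \<partial>M01) = integral {0<..<1} (\<lambda>t. indicator {a..b} t *\<^sub>R f t)"
    by (intro lebesgue_integral_eq_integral integrable_M01_indicator_Icc f) auto
  also have "\<dots> = integral {0..1} (\<lambda>t. indicator {a..b} t *\<^sub>R f t)"
    by (simp add: integral_open_interval_real)
  also have "\<dots> = integral {0..1} (\<lambda>t. if t \<in> {a..b} then f t else 0)"
    by (intro integral_cong) (auto simp: indicator_def)
  also have "\<dots> = integral {a..b} f"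
    using assms by (subst Henstock_Kurzweil_Integration.integral_restrict_Int) (simp add: Int_absorb2)
  finally show ?thesis .
qed

lemma integral_M01_eq:
  fixes f :: "real \<Rightarrow> 'a::euclidean_space"
  assumes "integrable M01 f"
  shows "integral\<^sup>L M01 f = integral {0..1} f"
  using lebesgue_integral_eq_integral[OF assms] by (simp add: integral_open_interval_real)

lemma continuous_imp_integrable_M01:
  fixes f :: "real \<Rightarrow> 'a::euclidean_space"
  assumes "continuous_on {0..1} f"
  shows "integrable M01 f"
proof -
  have "f absolutely_integrable_on {0<..<1}"
    using absolutely_integrable_continuous_real[OF assms]
      absolutely_integrable_on_open_interval[of "0::real" 1 f] by simp
  then show ?thesis
    by (intro absolutely_integrable_imp_integrable) auto
qed

lemma finite_measure_M01: "finite_measure M01"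
  by (intro finite_measure_lebesgue_on) auto

text \<open>Absolute continuity of \<open>F\<close> on the closed interval with density
  \<open>f\<close>. The integral formula is taken as the definition, so no almost everywhere
  differentiation theorem enters, and \<open>f\<close> can be changed on a null set.\<close>

definition is_primitive :: "(real \<Rightarrow> 'a::euclidean_space) \<Rightarrow> (real \<Rightarrow> 'a) \<Rightarrow> bool" where
  "is_primitive F f \<longleftrightarrow> integrable M01 f \<and> (\<forall>x\<in>{0..1}. F x = F 0 + integral {0..x} f)"

lemma is_primitive_eq:
  assumes "is_primitive F f" "x \<in> {0..1}"
  shows "F 0 + integral {0..x} f = F x"
  using assms unfolding is_primitive_def by metis

lemma is_primitive_integrable: "is_primitive F f \<Longrightarrow> integrable M01 f"
  by (simp add: is_primitive_def)

lemma is_primitive_continuous: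
  assumes "is_primitive F f"
  shows "continuous_on {0..1} F"
proof -
  have "continuous_on {0..1} (\<lambda>x. F 0 + integral {0..x} f)"
    by (intro continuous_on_add continuous_on_const indefinite_integral_continuous_1
        integrable_M01_imp_integrable_on is_primitive_integrable[OF assms])
  then show ?thesis
    by (rule continuous_on_eq) (rule is_primitive_eq[OF assms])
qed

lemma is_primitiveI:
  assumes "\<And>x. x \<in> {0..1} \<Longrightarrow> (F has_vector_derivative f x) (at x within {0..1})"
    and "continuous_on {0..1} f"
  shows "is_primitive F f"
  unfolding is_primitive_def
proof (intro conjI ballI continuous_imp_integrable_M01 assms)
  fix x :: real assume x: "x \<in> {0..1}"
  have "(f has_integral (F x - F 0)) {0..x}"
    by (rule fundamental_theorem_of_calculus)
       (use x in \<open>auto intro: has_vector_derivative_within_subset[OF assms(1)]\<close>)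
  then show "F x = F 0 + integral {0..x} f"
    by (simp add: integral_unique)
qed

lemma is_primitive_has_vector_derivative:
  assumes "is_primitive F f" "continuous_on {0..1} f" "x \<in> {0..1}"
  shows "(F has_vector_derivative f x) (at x within {0..1})"
proof -
  have "((\<lambda>x. F 0 + integral {0..x} f) has_vector_derivative 0 + f x) (at x within {0..1})"
    by (rule has_vector_derivative_add[OF has_vector_derivative_const integral_has_vector_derivative[OF assms(2,3)]])
  then have "((\<lambda>x. F 0 + integral {0..x} f) has_vector_derivative f x) (at x within {0..1})"
    by simp
  moreover have "F y = F 0 + integral {0..y} f" if "y \<in> {0..1}" for y
    using is_primitive_eq[OF assms(1) that] by simp
  ultimately show ?thesis
    using has_vector_derivative_transform[OF assms(3), of F "\<lambda>x. F 0 + integral {0..x} f" "f x"] by blast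
qed

section \<open>Bilinear products of integrable functions and integration by parts\<close>

lemma integrable_bilinear_continuous:
  fixes prod :: "'a::euclidean_space \<Rightarrow> 'b::euclidean_space \<Rightarrow> 'c::euclidean_space"
  assumes "bounded_bilinear prod" and f: "integrable M01 f" and G: "continuous_on {0..1} G"
  shows "integrable M01 (\<lambda>x. prod (f x) (G x))"
proof -
  interpret bounded_bilinear prod by fact
  obtain K where K: "0 < K" "norm (prod u v) \<le> norm u * norm v * K" for u v
    using pos_bounded by blast
  obtain B where "\<forall>y\<in>G ` {0..1}. norm y \<le> B"
    using compact_imp_bounded[OF compact_continuous_image[OF G compact_Icc]] unfolding bounded_iff by blast
  then have B: "norm (G x) \<le> B" if "x \<in> {0..1}" for x
    using that by blast
  have cont: "continuous_on UNIV (\<lambda>p. prod (fst p) (snd p))"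
    by (rule continuous_on[OF continuous_on_fst[OF continuous_on_id] continuous_on_snd[OF continuous_on_id]])
  have "G \<in> borel_measurable M01"
    using continuous_imp_integrable_M01[OF G] by simp
  then have meas: "(\<lambda>x. prod (f x) (G x)) \<in> borel_measurable M01"
    using borel_measurable_continuous_on[OF cont borel_measurable_Pair[OF borel_measurable_integrable[OF f]]]
    by simp
  show ?thesis
  proof (rule Bochner_Integration.integrable_bound[OF _ meas])
    show "integrable M01 (\<lambda>x. norm (f x) * (B * K))"
      using f by simp
    show "AE x in M01. norm (prod (f x) (G x)) \<le> norm (norm (f x) * (B * K))"
    proof (rule AE_I2)
      fix x :: real assume "x \<in> space M01"
      then have "norm (G x) \<le> B" by (intro B) auto
      then have "norm (f x) * norm (G x) * K \<le> norm (f x) * B * K"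
        using K(1) by (intro mult_right_mono mult_left_mono) auto
      then show "norm (prod (f x) (G x)) \<le> norm (norm (f x) * (B * K))"
        using K(2)[of "f x" "G x"] by (simp add: mult.assoc)
    qed
  qed
qed

lemma integrable_continuous_scaleR:
  fixes f :: "real \<Rightarrow> 'a::euclidean_space"
  assumes "continuous_on {0..1} \<theta>" "integrable M01 f"
  shows "integrable M01 (\<lambda>x. \<theta> x *\<^sub>R f x)"
  using integrable_bilinear_continuous[OF bounded_bilinear.flip[OF bounded_bilinear_scaleR] assms(2,1)]
  by simp

lemma integrable_pair_bilinear:
  fixes prod :: "'a::euclidean_space \<Rightarrow> 'b::euclidean_space \<Rightarrow> 'c::euclidean_space"
  assumes "bounded_bilinear prod" and M: "sigma_finite_measure M" and N: "sigma_finite_measure N"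
    and f: "integrable M f" and g: "integrable N g"
  shows "integrable (M \<Otimes>\<^sub>M N) (\<lambda>z. prod (f (fst z)) (g (snd z)))"
proof -
  interpret bounded_bilinear prod by fact
  interpret pair_sigma_finite M N using M N by (simp add: pair_sigma_finite_def)
  have [measurable]: "f \<in> borel_measurable M" "g \<in> borel_measurable N"
    using f g by auto
  have cont: "continuous_on UNIV (\<lambda>p. prod (fst p) (snd p))"
    by (rule continuous_on[OF continuous_on_fst[OF continuous_on_id] continuous_on_snd[OF continuous_on_id]])
  have "(\<lambda>z. f (fst z)) \<in> borel_measurable (M \<Otimes>\<^sub>M N)" "(\<lambda>z. g (snd z)) \<in> borel_measurable (M \<Otimes>\<^sub>M N)"
    by measurable
  from borel_measurable_continuous_on[OF cont borel_measurable_Pair[OF this]]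
  have meas: "(\<lambda>z. prod (f (fst z)) (g (snd z))) \<in> borel_measurable (M \<Otimes>\<^sub>M N)"
    by simp
  obtain K where K: "0 < K" "norm (prod u v) \<le> norm u * norm v * K" for u v
    using pos_bounded by blast
  have "integrable (M \<Otimes>\<^sub>M N) (\<lambda>z. norm (f (fst z)) * norm (g (snd z)))"
    using f g by (intro Fubini_integrable) auto
  then have "integrable (M \<Otimes>\<^sub>M N) (\<lambda>z. norm (f (fst z)) * norm (g (snd z)) * K)"
    by simp
  then show ?thesis
    by (rule Bochner_Integration.integrable_bound[OF _ meas])
       (use K in \<open>auto intro!: AE_I2 order_trans[OF K(2)] simp: abs_mult\<close>)
qed

text \<open>Each summand on the left contributes one of the triangles t \<le> x and x \<le> t. They
  cover the square and overlap only in the diagonal, which is null on every slice, so their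
  integrals add up to the product of the two total integrals. A general bilinear product serves both
  \<open>scaleR\<close>, for pairing with test functions, and \<open>herm\<close>, for the boundary
  form of the operator.\<close>

theorem is_primitive_by_parts:
  fixes prod :: "'a::euclidean_space \<Rightarrow> 'b::euclidean_space \<Rightarrow> 'c::euclidean_space"
  assumes prod: "bounded_bilinear prod" and F: "is_primitive F f" and G: "is_primitive G g"
  shows "(\<integral>x. prod (f x) (G x) \<partial>M01) + (\<integral>x. prod (F x) (g x) \<partial>M01) = prod (F 1) (G 1) - prod (F 0) (G 0)"
proof -
  interpret bounded_bilinear prod by fact
  interpret M: finite_measure M01 by (rule finite_measure_M01)
  interpret pair_sigma_finite M01 M01 ..
  have f: "integrable M01 f" and g: "integrable M01 g"
    using F G by (auto intro: is_primitive_integrable)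
  let ?S = "{z. snd z \<le> fst z} \<inter> space (M01 \<Otimes>\<^sub>M M01)" and ?T = "{z. fst z \<le> snd z} \<inter> space (M01 \<Otimes>\<^sub>M M01)"
  let ?p = "\<lambda>z. prod (f (fst z)) (g (snd z))"
  \<comment> \<open>\<open>M01\<close> carries the Lebesgue sigma-algebra. Through this map both
    coordinates become Borel functions on the product, which makes the two triangles
    measurable.\<close>
  have ident: "(\<lambda>x. x) \<in> borel_measurable M01"
    using id_borel_measurable_lebesgue_on[of "{0<..<1::real}"] by (simp add: id_def)
  have fst: "fst \<in> borel_measurable (M01 \<Otimes>\<^sub>M M01)" and snd: "snd \<in> borel_measurable (M01 \<Otimes>\<^sub>M M01)"
    using measurable_compose[OF measurable_fst ident] measurable_compose[OF measurable_snd ident] by auto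
  have S: "?S \<in> sets (M01 \<Otimes>\<^sub>M M01)" and T: "?T \<in> sets (M01 \<Otimes>\<^sub>M M01)"
    using borel_measurable_le[OF snd fst] borel_measurable_le[OF fst snd]
    by (simp_all add: Int_def conj_commute)
  note p = integrable_pair_bilinear[OF prod M.sigma_finite_measure_axioms M.sigma_finite_measure_axioms f g]
  note pS = integrable_mult_indicator[OF S p] and pT = integrable_mult_indicator[OF T p]
  have F_eq: "F x = F 0 + (\<integral>t. indicator {0..x} t *\<^sub>R f t \<partial>M01)"
    and G_eq: "G x = G 0 + (\<integral>t. indicator {0..x} t *\<^sub>R g t \<partial>M01)" if "x \<in> {0..1}" for x
    using that is_primitive_eq[OF F that] is_primitive_eq[OF G that]
      integral_M01_Icc[OF f, of 0 x] integral_M01_Icc[OF g, of 0 x] by auto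
  have "(\<integral>x. prod (f x) (G x) \<partial>M01) =
      (\<integral>x. prod (f x) (G 0) + (\<integral>t. indicator ?S (x, t) *\<^sub>R ?p (x, t) \<partial>M01) \<partial>M01)"
  proof (rule Bochner_Integration.integral_cong[OF refl])
    fix x :: real assume x: "x \<in> space M01"
    have "prod (f x) (G x) = prod (f x) (G 0) + prod (f x) (\<integral>t. indicator {0..x} t *\<^sub>R g t \<partial>M01)"
      using x by (subst G_eq) (auto simp: add_right)
    also have "prod (f x) (\<integral>t. indicator {0..x} t *\<^sub>R g t \<partial>M01) =
        (\<integral>t. prod (f x) (indicator {0..x} t *\<^sub>R g t) \<partial>M01)"
      by (rule integral_bounded_linear[OF bounded_linear_right integrable_M01_indicator_Icc[OF g], symmetric])
    also have "\<dots> = (\<integral>t. indicator ?S (x, t) *\<^sub>R ?p (x, t) \<partial>M01)"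
      using x by (intro Bochner_Integration.integral_cong) (auto simp: indicator_def space_pair_measure scaleR_right zero_right)
    finally show "prod (f x) (G x) = prod (f x) (G 0) + (\<integral>t. indicator ?S (x, t) *\<^sub>R ?p (x, t) \<partial>M01)" .
  qed
  also have "\<dots> = (\<integral>x. prod (f x) (G 0) \<partial>M01) + (\<integral>x. \<integral>t. indicator ?S (x, t) *\<^sub>R ?p (x, t) \<partial>M01 \<partial>M01)"
    by (intro Bochner_Integration.integral_add integrable_bounded_linear[OF bounded_linear_left f] integrable_fst'[OF pS])
  also have "\<dots> = prod (integral\<^sup>L M01 f) (G 0) + (\<integral>z. indicator ?S z *\<^sub>R ?p z \<partial>(M01 \<Otimes>\<^sub>M M01))"
    using integral_fst'[OF pS] integral_bounded_linear[OF bounded_linear_left f] by simp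
  finally have 1: "(\<integral>x. prod (f x) (G x) \<partial>M01) = \<dots>" .
  have pT': "integrable (M01 \<Otimes>\<^sub>M M01) (\<lambda>(x, t). indicator ?T (x, t) *\<^sub>R ?p (x, t))"
    using pT by (simp add: case_prod_unfold)
  have "(\<integral>t. prod (F t) (g t) \<partial>M01) =
      (\<integral>t. prod (F 0) (g t) + (\<integral>x. indicator ?T (x, t) *\<^sub>R ?p (x, t) \<partial>M01) \<partial>M01)"
  proof (rule Bochner_Integration.integral_cong[OF refl])
    fix t :: real assume t: "t \<in> space M01"
    have "prod (F t) (g t) = prod (F 0) (g t) + prod (\<integral>x. indicator {0..t} x *\<^sub>R f x \<partial>M01) (g t)"
      using t by (subst F_eq) (auto simp: add_left)
    also have "prod (\<integral>x. indicator {0..t} x *\<^sub>R f x \<partial>M01) (g t) =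
        (\<integral>x. prod (indicator {0..t} x *\<^sub>R f x) (g t) \<partial>M01)"
      by (rule integral_bounded_linear[OF bounded_linear_left integrable_M01_indicator_Icc[OF f], symmetric])
    also have "\<dots> = (\<integral>x. indicator ?T (x, t) *\<^sub>R ?p (x, t) \<partial>M01)"
      using t by (intro Bochner_Integration.integral_cong) (auto simp: indicator_def space_pair_measure scaleR_left zero_left)
    finally show "prod (F t) (g t) = prod (F 0) (g t) + (\<integral>x. indicator ?T (x, t) *\<^sub>R ?p (x, t) \<partial>M01)" .
  qed
  also have "\<dots> = (\<integral>t. prod (F 0) (g t) \<partial>M01) + (\<integral>t. \<integral>x. indicator ?T (x, t) *\<^sub>R ?p (x, t) \<partial>M01 \<partial>M01)"
    by (intro Bochner_Integration.integral_add integrable_bounded_linear[OF bounded_linear_right g]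
        integrable_snd[OF pT'])
  also have "\<dots> = prod (F 0) (integral\<^sup>L M01 g) + (\<integral>z. indicator ?T z *\<^sub>R ?p z \<partial>(M01 \<Otimes>\<^sub>M M01))"
    using integral_snd[OF pT'] integral_bounded_linear[OF bounded_linear_right g] by (simp add: case_prod_unfold)
  finally have 2: "(\<integral>x. prod (F x) (g x) \<partial>M01) = \<dots>" .
  have "(\<integral>z. indicator ?S z *\<^sub>R ?p z \<partial>(M01 \<Otimes>\<^sub>M M01)) + (\<integral>z. indicator ?T z *\<^sub>R ?p z \<partial>(M01 \<Otimes>\<^sub>M M01)) =
      (\<integral>z. indicator ?S z *\<^sub>R ?p z + indicator ?T z *\<^sub>R ?p z \<partial>(M01 \<Otimes>\<^sub>M M01))"
    by (rule Bochner_Integration.integral_add[OF pS pT, symmetric])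
  also have "\<dots> = (\<integral>x. \<integral>t. indicator ?S (x, t) *\<^sub>R ?p (x, t) + indicator ?T (x, t) *\<^sub>R ?p (x, t) \<partial>M01 \<partial>M01)"
    by (rule integral_fst'[OF Bochner_Integration.integrable_add[OF pS pT], symmetric])
  also have "\<dots> = (\<integral>x. prod (f x) (integral\<^sup>L M01 g) \<partial>M01)"
  proof (rule Bochner_Integration.integral_cong[OF refl])
    fix x :: real assume x: "x \<in> space M01"
    have diag: "AE t in M01. t \<noteq> x"
      by (rule AE_I[where N = "{x}"]) (use x in \<open>auto simp: emeasure_restrict_space sets_restrict_space_iff\<close>)
    have "(\<integral>t. indicator ?S (x, t) *\<^sub>R ?p (x, t) + indicator ?T (x, t) *\<^sub>R ?p (x, t) \<partial>M01) =
        (\<integral>t. prod (f x) (g t) \<partial>M01)"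
    proof (rule integral_cong_AE)
      show "(\<lambda>t. prod (f x) (g t)) \<in> borel_measurable M01"
        using integrable_bounded_linear[OF bounded_linear_right g] by simp
      show "(\<lambda>t. indicator ?S (x, t) *\<^sub>R ?p (x, t) + indicator ?T (x, t) *\<^sub>R ?p (x, t)) \<in> borel_measurable M01"
        using measurable_Pair2[OF borel_measurable_integrable[OF Bochner_Integration.integrable_add[OF pS pT]] x]
        by simp
      show "AE t in M01. indicator ?S (x, t) *\<^sub>R ?p (x, t) + indicator ?T (x, t) *\<^sub>R ?p (x, t) = prod (f x) (g t)"
        using diag AE_space by eventually_elim (use x in \<open>auto simp: indicator_def space_pair_measure\<close>)
    qed
    also have "\<dots> = prod (f x) (integral\<^sup>L M01 g)"
      by (rule integral_bounded_linear[OF bounded_linear_right g])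
    finally show "(\<integral>t. indicator ?S (x, t) *\<^sub>R ?p (x, t) + indicator ?T (x, t) *\<^sub>R ?p (x, t) \<partial>M01) =
        prod (f x) (integral\<^sup>L M01 g)" .
  qed
  also have "\<dots> = prod (integral\<^sup>L M01 f) (integral\<^sup>L M01 g)"
    by (rule integral_bounded_linear[OF bounded_linear_left f])
  finally have 3: "(\<integral>z. indicator ?S z *\<^sub>R ?p z \<partial>(M01 \<Otimes>\<^sub>M M01)) + (\<integral>z. indicator ?T z *\<^sub>R ?p z \<partial>(M01 \<Otimes>\<^sub>M M01)) =
      prod (integral\<^sup>L M01 f) (integral\<^sup>L M01 g)" .
  have "F 1 = F 0 + integral\<^sup>L M01 f" "G 1 = G 0 + integral\<^sup>L M01 g"
    using is_primitive_eq[OF F, of 1] is_primitive_eq[OF G, of 1] integral_M01_eq[OF f] integral_M01_eq[OF g]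
    by auto
  then have "prod (F 1) (G 1) - prod (F 0) (G 0) =
      prod (integral\<^sup>L M01 f) (G 0) + prod (F 0) (integral\<^sup>L M01 g) + prod (integral\<^sup>L M01 f) (integral\<^sup>L M01 g)"
    by (simp add: add_left add_right)
  then show ?thesis
    unfolding 1 2 3[symmetric] by simp
qed

section \<open>The lemma of du Bois-Reymond\<close>

text \<open>Henstock's lemma turns vanishing cell integrals into vanishing Riemann sums of the norm.\<close>

lemma norm_has_integral_0:
  fixes f :: "'m::euclidean_space \<Rightarrow> 'n::euclidean_space"
  assumes f: "f integrable_on cbox a b"
    and 0: "\<And>c d. cbox c d \<subseteq> cbox a b \<Longrightarrow> integral (cbox c d) f = 0"
  shows "((\<lambda>x. norm (f x)) has_integral 0) (cbox a b)"
  unfolding has_integral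
proof (intro allI impI)
  fix e :: real assume "0 < e"
  then obtain \<gamma> where "gauge \<gamma>"
    and \<gamma>: "\<And>p. p tagged_partial_division_of cbox a b \<Longrightarrow> \<gamma> fine p \<Longrightarrow>
      (\<Sum>(x,k)\<in>p. norm (measure lborel k *\<^sub>R f x - integral k f)) < e"
    by (rule Henstock_lemma[OF f]) blast
  have *: "norm ((\<Sum>(x,k)\<in>p. measure lborel k *\<^sub>R norm (f x)) - 0) < e"
    if p: "p tagged_division_of cbox a b" and "\<gamma> fine p" for p
  proof -
    have "(\<Sum>(x,k)\<in>p. measure lborel k *\<^sub>R norm (f x)) = (\<Sum>(x,k)\<in>p. norm (measure lborel k *\<^sub>R f x - integral k f))"
    proof (rule sum.cong[OF refl], clarify)
      fix x k assume "(x, k) \<in> p"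
      with p have "k \<subseteq> cbox a b" "\<exists>c d. k = cbox c d"
        by (auto simp: tagged_division_of_def tagged_partial_division_of_def)
      then have "integral k f = 0"
        using 0 by auto
      then show "measure lborel k *\<^sub>R norm (f x) = norm (measure lborel k *\<^sub>R f x - integral k f)"
        by simp
    qed
    also have "\<dots> < e"
      using \<gamma> p \<open>\<gamma> fine p\<close> by (auto simp: tagged_division_of_def)
    finally have "(\<Sum>(x,k)\<in>p. measure lborel k *\<^sub>R norm (f x)) < e" .
    moreover have "0 \<le> (\<Sum>(x,k)\<in>p. measure lborel k *\<^sub>R norm (f x))"
      by (intro sum_nonneg) (simp add: case_prod_unfold)
    ultimately show ?thesis
      by (simp only: real_norm_def diff_zero abs_of_nonneg)
  qed
  show "\<exists>\<gamma>. gauge \<gamma> \<and> (\<forall>\<D>. \<D> tagged_division_of cbox a b \<and> \<gamma> fine \<D> \<longrightarrow>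
      norm ((\<Sum>(x,k)\<in>\<D>. measure lborel k *\<^sub>R norm (f x)) - 0) < e)"
    by (intro exI[of _ \<gamma>] conjI allI impI \<open>gauge \<gamma>\<close>) (elim conjE, rule *)
qed

text \<open>On a closed interval inside (0, 1) all cell integrals vanish, hence so does the integral
  of the norm, and \<open>f\<close> is zero almost everywhere there. Countably many such intervals
  exhaust (0, 1).\<close>

lemma AE_M01_zero_if_integrals_zero:
  fixes f :: "real \<Rightarrow> 'a::euclidean_space"
  assumes f: "integrable M01 f"
    and 0: "\<And>a b. 0 < a \<Longrightarrow> a < b \<Longrightarrow> b < 1 \<Longrightarrow> integral {a..b} f = 0"
  shows "AE x in M01. f x = 0"
proof -
  have *: "AE x in M01. x \<in> {a..b} \<longrightarrow> f x = 0" if ab: "0 < a" "b < 1" for a b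
  proof -
    let ?g = "\<lambda>x. indicator {a..b} x *\<^sub>R f x"
    have fi: "f integrable_on {a..b}"
      using integrable_M01_imp_integrable_on[OF f] by (rule integrable_on_subinterval) (use ab in auto)
    have "integral (cbox c d) f = 0" if "cbox c d \<subseteq> cbox a b" for c d
      using 0[of c d] that ab by (cases c d rule: linorder_cases) auto
    with fi have "((\<lambda>x. norm (f x)) has_integral 0) {a..b}"
      using norm_has_integral_0[of f a b] by simp
    then have n0: "integral {a..b} (\<lambda>x. norm (f x)) = 0"
      by (rule integral_unique)
    have int: "integrable M01 (\<lambda>x. norm (f x))"
      using f by simp
    have "integrable M01 (\<lambda>x. norm (?g x))"
      by (intro integrable_norm integrable_M01_indicator_Icc f)
    moreover have "integral\<^sup>L M01 (\<lambda>x. norm (?g x)) = 0"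
      using integral_M01_Icc[OF int, of a b] n0 ab by simp
    ultimately have "AE x in M01. norm (?g x) = 0"
      by (subst (asm) integral_nonneg_eq_0_iff_AE) auto
    then show ?thesis
      using AE_space by eventually_elim (auto simp: indicator_def split: if_splits)
  qed
  \<comment> \<open>The shift by 3 keeps every interval of the exhaustion nondegenerate, beginning
    with [1/3, 2/3].\<close>
  have "AE x in M01. \<forall>n. x \<in> {1 / real (n + 3)..1 - 1 / real (n + 3)} \<longrightarrow> f x = 0"
    unfolding AE_all_countable by (intro allI *) auto
  then show ?thesis
    using AE_space
  proof eventually_elim
    case (elim x)
    then have x: "0 < x" "x < 1" by auto
    obtain n where n: "inverse (real (Suc n)) < min x (1 - x)"
      using reals_Archimedean[of "min x (1 - x)"] x by auto
    have "1 / real (n + 3) \<le> inverse (real (Suc n))"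
      by (simp add: field_simps)
    with n have "x \<in> {1 / real (n + 3)..1 - 1 / real (n + 3)}"
      by auto
    with elim(1) show ?case by blast
  qed
qed

section \<open>Pairing integrable functions with test functions\<close>

lemma test_function_continuous: "test_function \<theta> \<Longrightarrow> continuous_on S \<theta>"
  using smooth_continuous test_function_iff by blast

lemma test_function_integrable:
  fixes f :: "real \<Rightarrow> 'a::euclidean_space"
  assumes "test_function \<theta>" "integrable M01 f"
  shows "integrable M01 (\<lambda>x. \<theta> x *\<^sub>R f x)"
  by (rule integrable_continuous_scaleR[OF test_function_continuous[OF assms(1)] assms(2)])

lemma test_function_is_primitive:
  assumes "test_function \<theta>"
  shows "is_primitive \<theta> (deriv \<theta>)"
  by (rule is_primitiveI[OF _ test_function_continuous[OF test_function_deriv[OF assms]]])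
     (use smooth_has_derivative assms in \<open>auto simp: test_function_iff
       has_real_derivative_iff_has_vector_derivative intro: has_vector_derivative_at_within\<close>)

lemma test_function_ends: "test_function \<theta> \<Longrightarrow> \<theta> 0 = 0 \<and> \<theta> 1 = 0"
  unfolding test_function_iff by force

text \<open>The bumps lie between 0 and 1 and tend to the indicator of (a, b), so dominated
  convergence with majorant \<open>norm (h x)\<close> carries the hypothesis over to integrals on
  subintervals.\<close>

theorem fundamental_lemma_of_variations:
  fixes h :: "real \<Rightarrow> 'a::euclidean_space"
  assumes h: "integrable M01 h"
    and 0: "\<And>\<theta>. test_function \<theta> \<Longrightarrow> (\<integral>x. \<theta> x *\<^sub>R h x \<partial>M01) = 0"
  shows "AE x in M01. h x = 0"
proof (rule AE_M01_zero_if_integrals_zero[OF h])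
  fix a b :: real assume ab: "0 < a" "a < b" "b < 1"
  have "(\<lambda>n. \<integral>x. bump a b n x *\<^sub>R h x \<partial>M01) \<longlonglongrightarrow> (\<integral>x. indicator {a<..<b} x *\<^sub>R h x \<partial>M01)"
  proof (rule integral_dominated_convergence[where w = "\<lambda>x. norm (h x)"])
    have "integrable M01 (\<lambda>x. indicator {a<..<b} x *\<^sub>R h x)"
      by (intro integrable_mult_indicator h) (use ab in \<open>auto simp: sets_restrict_space_iff\<close>)
    then show "(\<lambda>x. indicator {a<..<b} x *\<^sub>R h x) \<in> borel_measurable M01"
      by simp
    show "(\<lambda>x. bump a b n x *\<^sub>R h x) \<in> borel_measurable M01" for n
      by (intro borel_measurable_integrable test_function_integrable test_function_bump ab h)
    show "AE x in M01. (\<lambda>n. bump a b n x *\<^sub>R h x) \<longlonglongrightarrow> indicator {a<..<b} x *\<^sub>R h x"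
      by (intro AE_I2 tendsto_scaleR bump_tendsto tendsto_const)
    show "AE x in M01. norm (bump a b n x *\<^sub>R h x) \<le> norm (h x)" for n
      using bump_nonneg[of a b n] bump_le_1[of a b n] by (auto intro!: AE_I2 mult_left_le_one_le)
  qed (use h in simp)
  moreover have "(\<lambda>n. \<integral>x. bump a b n x *\<^sub>R h x \<partial>M01) = (\<lambda>_. 0)"
    by (intro ext 0 test_function_bump ab)
  ultimately have "(\<integral>x. indicator {a<..<b} x *\<^sub>R h x \<partial>M01) = 0"
    by (simp add: LIMSEQ_const_iff)
  moreover have "integrable M01 (\<lambda>t. indicator {a<..<b} t *\<^sub>R h t)"
    by (intro integrable_mult_indicator h) (use ab in \<open>auto simp: sets_restrict_space_iff\<close>)
  from integral_M01_eq[OF this]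
  have "(\<integral>x. indicator {a<..<b} x *\<^sub>R h x \<partial>M01) = integral {0..1} (\<lambda>t. indicator {a<..<b} t *\<^sub>R h t)" .
  moreover have "\<dots> = integral {0..1} (\<lambda>t. if t \<in> {a<..<b} then h t else 0)"
    by (intro integral_cong) (auto simp: indicator_def)
  moreover have "\<dots> = integral {a<..<b} h"
    using ab by (subst Henstock_Kurzweil_Integration.integral_restrict_Int)
      (auto intro!: arg_cong2[where f = integral])
  ultimately show "integral {a..b} h = 0"
    by (simp add: integral_open_interval_real)
qed

text \<open>The integral from 0 vanishes to the left of the support and is constant to its right;
  mean zero says that this constant is 0.\<close>

lemma test_function_antiderivative:
  assumes \<eta>: "test_function \<eta>" and 0: "integral\<^sup>L M01 \<eta> = 0"
  obtains \<theta> where "test_function \<theta>" "deriv \<theta> = \<eta>"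
proof -
  obtain a b where sm: "smooth \<eta>" and ab: "0 < a" "a < b" "b < 1" and out: "\<And>x. x \<notin> {a..b} \<Longrightarrow> \<eta> x = 0"
    using \<eta> unfolding test_function_iff by blast
  define \<theta> where "\<theta> x = integral {0..x} \<eta>" for x
  have int: "\<eta> integrable_on {c..d}" for c d
    by (rule integrable_continuous_interval[OF test_function_continuous[OF \<eta>]])
  have tail: "integral {b..x} \<eta> = 0" for x
  proof -
    \<comment> \<open>\<open>out\<close> says nothing about the endpoint \<open>b\<close> itself,
      hence the passage to the open interval.\<close>
    have "integral {b..x} \<eta> = integral {b<..<x} \<eta>"
      by (rule integral_open_interval_real)
    also have "\<dots> = integral {b<..<x} (\<lambda>_. 0)"
      by (intro integral_cong out) auto
    finally show ?thesis by simp
  qed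
  have "integral {0..1} \<eta> = 0"
    using 0 integral_M01_eq[OF continuous_imp_integrable_M01[OF test_function_continuous[OF \<eta>]]] by simp
  then have b: "integral {0..b} \<eta> = 0"
    using Henstock_Kurzweil_Integration.integral_combine[of 0 b 1 \<eta>] int tail[of 1] ab by simp
  have \<theta>_out: "\<theta> x = 0" if "x \<notin> {a..b}" for x
  proof (cases "x < a")
    case True
    have "\<theta> x = integral {0..x} (\<lambda>_. 0)"
      unfolding \<theta>_def by (intro integral_cong out) (use True in auto)
    then show ?thesis by simp
  next
    case False
    then show ?thesis
      using Henstock_Kurzweil_Integration.integral_combine[of 0 b x \<eta>] int tail[of x] b that ab
      by (simp add: \<theta>_def)
  qed
  \<comment> \<open>The fundamental theorem yields a two-sided derivative only in the open unit
    interval. Every other point has a neighbourhood on which \<theta> vanishes.\<close>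
  have deriv: "(\<theta> has_real_derivative \<eta> x) (at x)" for x
  proof (cases "x \<in> {0<..<1}")
    case True
    have "(\<theta> has_vector_derivative \<eta> x) (at x within {0..1})"
      unfolding \<theta>_def[abs_def]
      by (rule integral_has_vector_derivative[OF test_function_continuous[OF \<eta>]]) (use True in auto)
    then have "(\<theta> has_vector_derivative \<eta> x) (at x within {0<..<1})"
      by (rule has_vector_derivative_within_subset) auto
    then show ?thesis
      using True at_within_open[of x "{0<..<1}"]
      by (simp add: has_real_derivative_iff_has_vector_derivative)
  next
    case False
    then have x: "x \<in> - {a..b}" using ab by auto
    have "(\<theta> has_real_derivative 0) (at x)"
      by (rule has_field_derivative_transform_within_open[of "\<lambda>_. 0" _ _ "- {a..b}"])
         (use x \<theta>_out in auto)
    then show ?thesis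
      using x out by simp
  qed
  have "smooth \<theta>"
    by (rule smooth_antiderivative[OF deriv sm])
  then have "test_function \<theta>"
    using ab \<theta>_out unfolding test_function_iff by blast
  moreover have "deriv \<theta> = \<eta>"
    using DERIV_imp_deriv[OF deriv] by auto
  ultimately show thesis by (rule that)
qed

text \<open>Provides the fixed function by which the mean of any other test function can be
  subtracted.\<close>

lemma exists_test_function_integral_pos:
  obtains \<omega> where "test_function \<omega>" "integral\<^sup>L M01 \<omega> > 0"
proof
  let ?\<omega> = "bump (1/4) (3/4) 1"
  show t: "test_function ?\<omega>"
    by (rule test_function_bump) auto
  have int: "integrable M01 ?\<omega>"
    by (rule continuous_imp_integrable_M01[OF test_function_continuous[OF t]])
  have "integral\<^sup>L M01 ?\<omega> \<noteq> 0"
  proof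
    assume "integral\<^sup>L M01 ?\<omega> = 0"
    then have "integral {0..1} ?\<omega> = 0"
      using integral_M01_eq[OF int] by simp
    then have "?\<omega> (1/2) = 0"
      using integral_eq_0_iff[of 0 1 ?\<omega>] test_function_continuous[OF t] bump_nonneg by auto
    with bump_inside[of "1/2" "1/4" "3/4" 1] show False by auto
  qed
  moreover have "0 \<le> integral\<^sup>L M01 ?\<omega>"
    by (intro Bochner_Integration.integral_nonneg bump_nonneg)
  ultimately show "integral\<^sup>L M01 ?\<omega> > 0" by simp
qed

text \<open>\<open>\<eta> - (\<integral>\<eta> / \<integral>\<omega>) \<omega>\<close> is the derivative of a test function for every test function \<open>\<eta>\<close>.\<close>

theorem du_bois_reymond:
  fixes w :: "real \<Rightarrow> 'a::euclidean_space"
  assumes w: "integrable M01 w"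
    and 0: "\<And>\<theta>. test_function \<theta> \<Longrightarrow> (\<integral>x. deriv \<theta> x *\<^sub>R w x \<partial>M01) = 0"
  obtains c where "AE x in M01. w x = c"
proof -
  obtain \<omega> where \<omega>: "test_function \<omega>" and pos: "integral\<^sup>L M01 \<omega> > 0"
    by (rule exists_test_function_integral_pos)
  interpret M: finite_measure M01 by (rule finite_measure_M01)
  \<comment> \<open>If \<open>w\<close> is constant, pairing it with \<omega> forces this
    value.\<close>
  define c where "c = (\<integral>x. \<omega> x *\<^sub>R w x \<partial>M01) /\<^sub>R integral\<^sup>L M01 \<omega>"
  have c: "integrable M01 (\<lambda>_. c)" by simp
  have "AE x in M01. w x - c = 0"
  proof (rule fundamental_lemma_of_variations)
    show "integrable M01 (\<lambda>x. w x - c)"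
      using w by simp
    fix \<eta> assume \<eta>: "test_function \<eta>"
    define r where "r = integral\<^sup>L M01 \<eta> / integral\<^sup>L M01 \<omega>"
    have int: "integrable M01 \<eta>" "integrable M01 \<omega>"
      using \<eta> \<omega> by (auto intro: continuous_imp_integrable_M01 test_function_continuous)
    have "test_function (\<lambda>x. \<eta> x + (- r) * \<omega> x)"
      by (rule test_function_combine[OF \<eta> \<omega>])
    moreover have "(\<integral>x. \<eta> x + (- r) * \<omega> x \<partial>M01) = 0"
      using int pos by (simp add: r_def)
    ultimately obtain \<theta> where \<theta>: "test_function \<theta>" "deriv \<theta> = (\<lambda>x. \<eta> x + (- r) * \<omega> x)"
      by (rule test_function_antiderivative)
    have "0 = (\<integral>x. \<eta> x *\<^sub>R w x - r *\<^sub>R (\<omega> x *\<^sub>R w x) \<partial>M01)"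
      using 0[OF \<theta>(1)] by (simp add: \<theta>(2) scaleR_diff_left)
    also have "\<dots> = (\<integral>x. \<eta> x *\<^sub>R w x \<partial>M01) - r *\<^sub>R (\<integral>x. \<omega> x *\<^sub>R w x \<partial>M01)"
      using test_function_integrable[OF \<eta> w] test_function_integrable[OF \<omega> w]
      by (simp del: scaleR_scaleR)
    also have "r *\<^sub>R (\<integral>x. \<omega> x *\<^sub>R w x \<partial>M01) = integral\<^sup>L M01 \<eta> *\<^sub>R c"
      using pos by (simp add: r_def c_def divide_inverse)
    also have "\<dots> = (\<integral>x. \<eta> x *\<^sub>R c \<partial>M01)"
      using int by simp
    also have "(\<integral>x. \<eta> x *\<^sub>R w x \<partial>M01) - \<dots> = (\<integral>x. \<eta> x *\<^sub>R (w x - c) \<partial>M01)"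
      using Bochner_Integration.integral_diff[OF test_function_integrable[OF \<eta> w] test_function_integrable[OF \<eta> c]]
      by (simp add: scaleR_diff_right)
    finally show "(\<integral>x. \<eta> x *\<^sub>R (w x - c) \<partial>M01) = 0" by simp
  qed
  then show thesis
    by (intro that[of c]) simp
qed

text \<open>Reduction to first order by adding a linear term. Since \<eta> - r \<omega> is the
  derivative of a test function, the hypothesis makes the pairing of \<eta>' with \<open>w\<close>
  equal to r times that of \<omega>' with \<open>w\<close>. This is the integral of \<eta> times a
  fixed vector \<open>k\<close>, and by parts it is the pairing of \<eta>' with - x k.\<close>

lemma du_bois_reymond_second_order:
  fixes w :: "real \<Rightarrow> 'a::euclidean_space"
  assumes w: "integrable M01 w"
    and 0: "\<And>\<theta>. test_function \<theta> \<Longrightarrow> (\<integral>x. deriv (deriv \<theta>) x *\<^sub>R w x \<partial>M01) = 0"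
  obtains c d where "AE x in M01. w x = c + x *\<^sub>R d"
proof -
  obtain \<omega> where \<omega>: "test_function \<omega>" and pos: "integral\<^sup>L M01 \<omega> > 0"
    by (rule exists_test_function_integral_pos)
  \<comment> \<open>By parts, \<omega>' paired with x k gives minus the integral of \<omega> times
    \<open>k\<close>; this choice makes w + x k annihilate \<omega>'.\<close>
  define k where "k = (\<integral>x. deriv \<omega> x *\<^sub>R w x \<partial>M01) /\<^sub>R integral\<^sup>L M01 \<omega>"
  have xk: "integrable M01 (\<lambda>x. x *\<^sub>R k)"
    by (intro continuous_imp_integrable_M01 continuous_intros)
  obtain c where "AE x in M01. w x + x *\<^sub>R k = c"
  proof (rule du_bois_reymond)
    show "integrable M01 (\<lambda>x. w x + x *\<^sub>R k)"
      using w xk by simp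
    fix \<eta> assume \<eta>: "test_function \<eta>"
    note \<eta>' = test_function_deriv[OF \<eta>] and \<omega>' = test_function_deriv[OF \<omega>]
    define r where "r = integral\<^sup>L M01 \<eta> / integral\<^sup>L M01 \<omega>"
    have int: "integrable M01 \<eta>" "integrable M01 \<omega>"
      using \<eta> \<omega> by (auto intro: continuous_imp_integrable_M01 test_function_continuous)
    have "test_function (\<lambda>x. \<eta> x + (- r) * \<omega> x)"
      by (rule test_function_combine[OF \<eta> \<omega>])
    moreover have "(\<integral>x. \<eta> x + (- r) * \<omega> x \<partial>M01) = 0"
      using int pos by (simp add: r_def)
    ultimately obtain \<theta> where \<theta>: "test_function \<theta>" "deriv \<theta> = (\<lambda>x. \<eta> x + (- r) * \<omega> x)"
      by (rule test_function_antiderivative)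
    have "((\<lambda>x. \<eta> x + (- r) * \<omega> x) has_real_derivative deriv \<eta> x + (- r) * deriv \<omega> x) (at x)" for x
      using \<eta> \<omega> by (intro DERIV_add DERIV_cmult smooth_has_derivative) (auto simp: test_function_iff)
    then have \<theta>'': "deriv (deriv \<theta>) = (\<lambda>x. deriv \<eta> x + (- r) * deriv \<omega> x)"
      unfolding \<theta>(2) using DERIV_imp_deriv by blast
    have "0 = (\<integral>x. deriv \<eta> x *\<^sub>R w x - r *\<^sub>R (deriv \<omega> x *\<^sub>R w x) \<partial>M01)"
      using 0[OF \<theta>(1)] by (simp add: \<theta>'' scaleR_diff_left)
    also have "\<dots> = (\<integral>x. deriv \<eta> x *\<^sub>R w x \<partial>M01) - r *\<^sub>R (\<integral>x. deriv \<omega> x *\<^sub>R w x \<partial>M01)"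
      using test_function_integrable[OF \<eta>' w] test_function_integrable[OF \<omega>' w]
      by (simp del: scaleR_scaleR)
    also have "r *\<^sub>R (\<integral>x. deriv \<omega> x *\<^sub>R w x \<partial>M01) = (\<integral>x. \<eta> x *\<^sub>R k \<partial>M01)"
      using pos int by (simp add: r_def k_def divide_inverse)
    also have "\<dots> = - (\<integral>x. deriv \<eta> x *\<^sub>R (x *\<^sub>R k) \<partial>M01)"
    proof -
      have "is_primitive (\<lambda>x. x *\<^sub>R k) (\<lambda>_. k)"
        by (rule is_primitiveI) (auto intro!: derivative_eq_intros)
      from is_primitive_by_parts[OF bounded_bilinear_scaleR test_function_is_primitive[OF \<eta>] this]
      show ?thesis
        using test_function_ends[OF \<eta>] by (simp add: add_eq_0_iff)
    qed
    finally have "(\<integral>x. deriv \<eta> x *\<^sub>R w x \<partial>M01) + (\<integral>x. deriv \<eta> x *\<^sub>R (x *\<^sub>R k) \<partial>M01) = 0"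
      by simp
    then show "(\<integral>x. deriv \<eta> x *\<^sub>R (w x + x *\<^sub>R k) \<partial>M01) = 0"
      using Bochner_Integration.integral_add[OF test_function_integrable[OF \<eta>' w] test_function_integrable[OF \<eta>' xk]]
      by (simp add: scaleR_add_right)
  qed
  then have "AE x in M01. w x = c + x *\<^sub>R (- k)"
    by eventually_elim (simp add: algebra_simps)
  then show thesis by (rule that)
qed

section \<open>Weak second derivatives and iterated primitives\<close>

lemma is_primitive_add:
  assumes F: "is_primitive F f" and G: "is_primitive G g"
  shows "is_primitive (\<lambda>x. F x + G x) (\<lambda>x. f x + g x)"
  unfolding is_primitive_def
proof (intro conjI ballI)
  note f = is_primitive_integrable[OF F] and g = is_primitive_integrable[OF G]
  then show "integrable M01 (\<lambda>x. f x + g x)" by simp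
  fix x :: real assume x: "x \<in> {0..1}"
  have "f integrable_on {0..x}" "g integrable_on {0..x}"
    using f[THEN integrable_M01_imp_integrable_on] g[THEN integrable_M01_imp_integrable_on] x
    by (auto elim!: integrable_on_subinterval)
  then have int: "integral {0..x} (\<lambda>x. f x + g x) = integral {0..x} f + integral {0..x} g"
    by (rule Henstock_Kurzweil_Integration.integral_add)
  have "F x + G x = (F 0 + integral {0..x} f) + (G 0 + integral {0..x} g)"
    by (simp only: is_primitive_eq[OF F x] is_primitive_eq[OF G x])
  then show "F x + G x = F 0 + G 0 + integral {0..x} (\<lambda>x. f x + g x)"
    by (simp only: int add.assoc add.left_commute)
qed

lemma is_primitive_integral:
  assumes "integrable M01 f"
  shows "is_primitive (\<lambda>x. integral {0..x} f) f"
  using assms by (simp add: is_primitive_def)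

lemma is_primitive_bounded_linear:
  assumes T: "bounded_linear T" and F: "is_primitive F f"
  shows "is_primitive (\<lambda>x. T (F x)) (\<lambda>x. T (f x))"
  unfolding is_primitive_def
proof (intro conjI ballI)
  note f = is_primitive_integrable[OF F]
  show "integrable M01 (\<lambda>x. T (f x))"
    by (rule integrable_bounded_linear[OF T f])
  fix x :: real assume x: "x \<in> {0..1}"
  have "f integrable_on {0..x}"
    using integrable_M01_imp_integrable_on[OF f] x by (auto elim!: integrable_on_subinterval)
  from integral_linear[OF this T]
  have "integral {0..x} (\<lambda>x. T (f x)) = T (integral {0..x} f)"
    by (simp add: o_def)
  then show "T (F x) = T (F 0) + integral {0..x} (\<lambda>x. T (f x))"
    using is_primitive_eq[OF F x] linear_add[OF bounded_linear.linear[OF T], of "F 0" "integral {0..x} f"] by simp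
qed

text \<open>Two integrations by parts; their boundary terms vanish because \<theta> and its
  derivative are both zero at 0 and 1.\<close>

lemma primitive_imp_weak_deriv2:
  assumes u: "is_primitive u v" and v: "is_primitive v g" and \<theta>: "test_function \<theta>"
  shows "(\<integral>x. deriv (deriv \<theta>) x *\<^sub>R u x \<partial>M01) = (\<integral>x. \<theta> x *\<^sub>R g x \<partial>M01)"
proof -
  note \<theta>' = test_function_deriv[OF \<theta>]
  have "(\<integral>x. deriv (deriv \<theta>) x *\<^sub>R u x \<partial>M01) + (\<integral>x. deriv \<theta> x *\<^sub>R v x \<partial>M01) = 0"
    using is_primitive_by_parts[OF bounded_bilinear_scaleR test_function_is_primitive[OF \<theta>'] u]
      test_function_ends[OF \<theta>'] by simp
  moreover have "(\<integral>x. deriv \<theta> x *\<^sub>R v x \<partial>M01) + (\<integral>x. \<theta> x *\<^sub>R g x \<partial>M01) = 0"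
    using is_primitive_by_parts[OF bounded_bilinear_scaleR test_function_is_primitive[OF \<theta>] v]
      test_function_ends[OF \<theta>] by simp
  ultimately show ?thesis
    by (simp add: add_eq_0_iff)
qed

text \<open>The twice iterated integral of \<open>g\<close> has the same weak second derivative as
  \<open>f\<close>, so the two differ almost everywhere by an affine function. Adding that function
  to the iterated integral gives the representative.\<close>

lemma weak_deriv2_imp_primitive:
  fixes f g :: "real \<Rightarrow> 'a::euclidean_space"
  assumes f: "integrable M01 f" and g: "integrable M01 g"
    and eq: "\<And>\<theta>. test_function \<theta> \<Longrightarrow> (\<integral>x. deriv (deriv \<theta>) x *\<^sub>R f x \<partial>M01) = (\<integral>x. \<theta> x *\<^sub>R g x \<partial>M01)"
  obtains u v where "is_primitive u v" "is_primitive v g" "AE x in M01. u x = f x"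
proof -
  define v0 where "v0 x = integral {0..x} g" for x
  define u0 where "u0 x = integral {0..x} v0" for x
  have v0: "is_primitive v0 g"
    unfolding v0_def[abs_def] by (rule is_primitive_integral[OF g])
  have u0: "is_primitive u0 v0"
    unfolding u0_def[abs_def]
    by (rule is_primitive_integral[OF continuous_imp_integrable_M01[OF is_primitive_continuous[OF v0]]])
  note u0i = continuous_imp_integrable_M01[OF is_primitive_continuous[OF u0]]
  obtain c d where cd: "AE x in M01. f x - u0 x = c + x *\<^sub>R d"
  proof (rule du_bois_reymond_second_order)
    show "integrable M01 (\<lambda>x. f x - u0 x)"
      using f u0i by simp
    fix \<theta> assume \<theta>: "test_function \<theta>"
    note \<theta>'' = test_function_deriv[OF test_function_deriv[OF \<theta>]]
    show "(\<integral>x. deriv (deriv \<theta>) x *\<^sub>R (f x - u0 x) \<partial>M01) = 0"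
      using Bochner_Integration.integral_diff[OF test_function_integrable[OF \<theta>'' f] test_function_integrable[OF \<theta>'' u0i]]
        eq[OF \<theta>] primitive_imp_weak_deriv2[OF u0 v0 \<theta>]
      by (simp add: scaleR_diff_right)
  qed
  have d: "is_primitive (\<lambda>_. d) (\<lambda>_. 0)"
    by (rule is_primitiveI) (auto intro!: derivative_eq_intros)
  have cxd: "is_primitive (\<lambda>x. c + x *\<^sub>R d) (\<lambda>_. d)"
    by (rule is_primitiveI) (auto intro!: derivative_eq_intros)
  show thesis
  proof (rule that)
    show "is_primitive (\<lambda>x. u0 x + (c + x *\<^sub>R d)) (\<lambda>x. v0 x + d)"
      by (rule is_primitive_add[OF u0 cxd])
    show "is_primitive (\<lambda>x. v0 x + d) g"
      using is_primitive_add[OF v0 d] by simp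
    show "AE x in M01. u0 x + (c + x *\<^sub>R d) = f x"
      using cd by eventually_elim (simp add: algebra_simps)
  qed
qed

section \<open>Elements of the Sobolev space\<close>

lemma l2rel_rep: "l2rel (rep_l2 f) (rep_l2 f)"
  by (rule Quotient_rep_reflp[OF Quotient_l2])

lemma sq_integrable_rep: "sq_integrable (rep_l2 f)"
  using l2rel_rep by (simp add: l2rel_def)

lemma l2_eqI:
  assumes "AE x in M01. rep_l2 f x = rep_l2 g x"
  shows "f = g"
  using assms sq_integrable_rep Quotient_rel_rep[OF Quotient_l2, of f g] by (simp add: l2rel_def)

lemma rep_abs_l2:
  assumes "sq_integrable h"
  shows "AE x in M01. rep_l2 (abs_l2 h) x = h x"
  using Quotient_rep_abs[OF Quotient_l2, of h] assms by (simp add: l2rel_def)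

lemma l2_inner_rep: "l2_inner f g = (\<integral>x. herm (rep_l2 f x) (rep_l2 g x) \<partial>M01)"
  by (simp add: l2_inner_def)

lemma represents_rep: "represents u f \<longleftrightarrow> (AE x in M01. u x = rep_l2 f x)"
  by (simp add: represents_def)

lemma has_gen_deriv2_rep:
  "has_gen_deriv2 f g \<longleftrightarrow> (\<forall>\<theta>. test_function \<theta> \<longrightarrow>
     (\<integral>x. deriv (deriv \<theta>) x *\<^sub>R rep_l2 f x \<partial>M01) = (\<integral>x. \<theta> x *\<^sub>R rep_l2 g x \<partial>M01))"
  by (simp add: has_gen_deriv2_def numeral_2_eq_2)

lemma rep_l2_matrix: "AE x in M01. rep_l2 (l2_matrix A f) x = A *v rep_l2 f x"
  using rep_abs_l2[OF sq_integrable_matrix[OF sq_integrable_rep]] by (simp add: l2_matrix_def)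

lemma sq_integrable_imp_integrable:
  assumes "sq_integrable f"
  shows "integrable M01 f"
proof -
  interpret finite_measure M01 by (rule finite_measure_M01)
  have meas: "f \<in> borel_measurable M01" and int: "integrable M01 (\<lambda>x. (norm (f x))\<^sup>2)"
    using assms by (auto simp: sq_integrable_def)
  have bound: "t \<le> 1 + t\<^sup>2" for t :: real
    using zero_le_power2[of "t - 1 / 2"] by (simp add: power2_eq_square algebra_simps)
  have "integrable M01 (\<lambda>x. 1 + (norm (f x))\<^sup>2)"
    using int by simp
  then show ?thesis
    by (rule Bochner_Integration.integrable_bound[OF _ meas]) (use bound in auto)
qed

lemma integrable_rep_l2: "integrable M01 (rep_l2 f)"
  by (rule sq_integrable_imp_integrable[OF sq_integrable_rep])

lemma continuous_imp_sq_integrable: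
  assumes "continuous_on {0..1} f"
  shows "sq_integrable f"
  unfolding sq_integrable_def
proof
  show "f \<in> borel_measurable M01"
    using continuous_imp_integrable_M01[OF assms] by simp
  show "integrable M01 (\<lambda>x. (norm (f x))\<^sup>2)"
    by (rule continuous_imp_integrable_M01[OF continuous_on_power[OF continuous_on_norm[OF assms]]])
qed

section \<open>Absolutely continuous representatives and their boundary values\<close>

lemma is_primitive_cong_AE:
  assumes F: "is_primitive F f" and g: "g \<in> borel_measurable M01" and eq: "AE x in M01. f x = g x"
  shows "is_primitive F g"
  unfolding is_primitive_def
proof (intro conjI ballI)
  note f = is_primitive_integrable[OF F]
  show int: "integrable M01 g"
    using integrable_cong_AE[OF borel_measurable_integrable[OF f] g eq] f by simp
  fix x :: real assume x: "x \<in> {0..1}"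
  have "(\<integral>t. indicator {0..x} t *\<^sub>R f t \<partial>M01) = (\<integral>t. indicator {0..x} t *\<^sub>R g t \<partial>M01)"
    by (rule integral_cong_AE)
       (use eq integrable_M01_indicator_Icc[OF f] integrable_M01_indicator_Icc[OF int] in auto)
  then have "integral {0..x} f = integral {0..x} g"
    using x integral_M01_Icc[OF f, of 0 x] integral_M01_Icc[OF int, of 0 x] by simp
  then show "F x = F 0 + integral {0..x} g"
    using is_primitive_eq[OF F x] by simp
qed

text \<open>The working form of membership in \<open>W22\<close>: a C1 representative
  \<open>u\<close>, its derivative \<open>v\<close>, and the class \<open>g\<close> of the second
  derivative. It replaces the choice operators in \<open>C1_rep\<close> and
  \<open>gen_deriv2\<close> by explicit witnesses.\<close>

definition W22_rep :: "l2 \<Rightarrow> (real \<Rightarrow> complex^2) \<Rightarrow> (real \<Rightarrow> complex^2) \<Rightarrow> l2 \<Rightarrow> bool" where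
  "W22_rep f u v g \<longleftrightarrow> represents u f \<and> is_primitive u v \<and> is_primitive v (rep_l2 g)"

lemma W22_rep_abs:
  assumes "is_primitive u v" "is_primitive v g" "sq_integrable g"
  shows "W22_rep (abs_l2 u) u v (abs_l2 g)"
  unfolding W22_rep_def represents_rep
proof (intro conjI assms)
  show "AE x in M01. u x = rep_l2 (abs_l2 u) x"
    using rep_abs_l2[OF continuous_imp_sq_integrable[OF is_primitive_continuous[OF assms(1)]]]
    by eventually_elim simp
  show "is_primitive v (rep_l2 (abs_l2 g))"
  proof (rule is_primitive_cong_AE[OF assms(2)])
    show "rep_l2 (abs_l2 g) \<in> borel_measurable M01"
      using integrable_rep_l2 by (rule borel_measurable_integrable)
    show "AE x in M01. g x = rep_l2 (abs_l2 g) x"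
      using rep_abs_l2[OF assms(3)] by eventually_elim simp
  qed
qed

theorem has_gen_deriv2_iff: "has_gen_deriv2 f g \<longleftrightarrow> (\<exists>u v. W22_rep f u v g)"
proof
  assume "has_gen_deriv2 f g"
  then have "(\<integral>x. deriv (deriv \<theta>) x *\<^sub>R rep_l2 f x \<partial>M01) = (\<integral>x. \<theta> x *\<^sub>R rep_l2 g x \<partial>M01)"
    if "test_function \<theta>" for \<theta>
    using that by (simp only: has_gen_deriv2_rep)
  then obtain u v where "is_primitive u v" "is_primitive v (rep_l2 g)" "AE x in M01. u x = rep_l2 f x"
    by (rule weak_deriv2_imp_primitive[OF integrable_rep_l2[of f] integrable_rep_l2[of g]])
  then show "\<exists>u v. W22_rep f u v g"
    unfolding W22_rep_def represents_rep by blast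
next
  assume "\<exists>u v. W22_rep f u v g"
  then obtain u v where u: "AE x in M01. u x = rep_l2 f x"
    and uv: "is_primitive u v" "is_primitive v (rep_l2 g)"
    unfolding W22_rep_def represents_rep by blast
  show "has_gen_deriv2 f g"
    unfolding has_gen_deriv2_rep
  proof (intro allI impI)
    fix \<theta> assume \<theta>: "test_function \<theta>"
    note \<theta>'' = test_function_deriv[OF test_function_deriv[OF \<theta>]]
    have "(\<integral>x. deriv (deriv \<theta>) x *\<^sub>R rep_l2 f x \<partial>M01) = (\<integral>x. deriv (deriv \<theta>) x *\<^sub>R u x \<partial>M01)"
    proof (rule integral_cong_AE)
      show "AE x in M01. deriv (deriv \<theta>) x *\<^sub>R rep_l2 f x = deriv (deriv \<theta>) x *\<^sub>R u x"
        using u by eventually_elim simp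
    qed (intro borel_measurable_integrable test_function_integrable \<theta>'' integrable_rep_l2
        continuous_imp_integrable_M01[OF is_primitive_continuous[OF uv(1)]])+
    then show "(\<integral>x. deriv (deriv \<theta>) x *\<^sub>R rep_l2 f x \<partial>M01) = (\<integral>x. \<theta> x *\<^sub>R rep_l2 g x \<partial>M01)"
      using primitive_imp_weak_deriv2[OF uv \<theta>] by simp
  qed
qed

text \<open>Makes the definite descriptions in \<open>gen_deriv2\<close> and, through the
  characterisation of the adjoint relation, in \<open>op_adjoint\<close> meaningful.\<close>

lemma has_gen_deriv2_unique:
  assumes "has_gen_deriv2 f g" "has_gen_deriv2 f h"
  shows "g = h"
proof (rule l2_eqI)
  have "AE x in M01. rep_l2 g x - rep_l2 h x = 0"
  proof (rule fundamental_lemma_of_variations)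
    show "integrable M01 (\<lambda>x. rep_l2 g x - rep_l2 h x)"
      by (intro Bochner_Integration.integrable_diff integrable_rep_l2)
    fix \<theta> assume \<theta>: "test_function \<theta>"
    then have "(\<integral>x. \<theta> x *\<^sub>R rep_l2 g x \<partial>M01) = (\<integral>x. \<theta> x *\<^sub>R rep_l2 h x \<partial>M01)"
      using assms unfolding has_gen_deriv2_rep by metis
    then show "(\<integral>x. \<theta> x *\<^sub>R (rep_l2 g x - rep_l2 h x) \<partial>M01) = 0"
      using Bochner_Integration.integral_diff[OF test_function_integrable[OF \<theta> integrable_rep_l2[of g]]
          test_function_integrable[OF \<theta> integrable_rep_l2[of h]]]
      by (simp add: scaleR_diff_right)
  qed
  then show "AE x in M01. rep_l2 g x = rep_l2 h x"
    by simp
qed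

lemma W22_rep_gen_deriv2:
  assumes "W22_rep f u v g"
  shows "has_gen_deriv2 f g" "gen_deriv2 f = g" "f \<in> W22"
proof -
  show *: "has_gen_deriv2 f g"
    using assms has_gen_deriv2_iff by blast
  then show "gen_deriv2 f = g"
    unfolding gen_deriv2_def using has_gen_deriv2_unique by blast
  show "f \<in> W22"
    using * by (auto simp: W22_def)
qed

lemma W22E:
  assumes "f \<in> W22"
  obtains u v where "W22_rep f u v (gen_deriv2 f)"
  using assms has_gen_deriv2_iff W22_rep_gen_deriv2 unfolding W22_def by fastforce

text \<open>The endpoints are covered although \<open>M01\<close> does not see them: the norm of the
  difference is continuous on the closed interval and has integral 0, so it vanishes throughout.
  Boundary values rest on this.\<close>

lemma continuous_AE_M01_imp_eq:
  fixes u w :: "real \<Rightarrow> 'a::euclidean_space"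
  assumes u: "continuous_on {0..1} u" and w: "continuous_on {0..1} w"
    and eq: "AE x in M01. u x = w x" and x: "x \<in> {0..1}"
  shows "u x = w x"
proof -
  let ?h = "\<lambda>x. norm (u x - w x)"
  have h: "continuous_on {0..1} ?h"
    by (intro continuous_on_norm continuous_on_diff u w)
  have "integral\<^sup>L M01 ?h = 0"
    by (rule integral_eq_zero_AE) (use eq in auto)
  then have "integral {0..1} ?h = 0"
    using integral_M01_eq[OF continuous_imp_integrable_M01[OF h]] by simp
  then show ?thesis
    using integral_eq_0_iff[OF h] x by auto
qed

text \<open>\<open>C1_rep\<close> is an unspecified choice, but any two continuous representatives
  agree on the closed interval, and then so do their derivatives within it.\<close>

lemma W22_rep_point:
  assumes f: "W22_rep f u v g" and x: "x \<in> {0..1}"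
  shows "point_val f x = u x" "point_deriv f x = v x"
proof -
  have u: "represents u f" "is_primitive u v" and v: "continuous_on {0..1} v"
    using f is_primitive_continuous by (auto simp: W22_rep_def)
  have du: "(u has_vector_derivative v y) (at y within {0..1})" if "y \<in> {0..1}" for y
    by (rule is_primitive_has_vector_derivative[OF u(2) v that])
  have "C1_on_unit u"
    unfolding C1_on_unit_def using du v by blast
  then have "C1_on_unit u \<and> represents u f"
    using u(1) by simp
  then have "C1_on_unit (C1_rep f) \<and> represents (C1_rep f) f"
    unfolding C1_rep_def by (rule someI[of "\<lambda>u. C1_on_unit u \<and> represents u f"])
  then obtain c' where c': "\<And>y. y \<in> {0..1} \<Longrightarrow> (C1_rep f has_vector_derivative c' y) (at y within {0..1})"
    and c: "AE x in M01. C1_rep f x = rep_l2 f x"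
    unfolding C1_on_unit_def represents_rep by blast
  have "continuous_on {0..1} (C1_rep f)"
    unfolding continuous_on_eq_continuous_within
    using c' has_vector_derivative_continuous by blast
  moreover have "AE x in M01. C1_rep f x = u x"
    using c u(1)[unfolded represents_rep] by eventually_elim simp
  ultimately have eq: "C1_rep f y = u y" if "y \<in> {0..1}" for y
    using continuous_AE_M01_imp_eq[OF _ is_primitive_continuous[OF u(2)] _ that] by blast
  show "point_val f x = u x"
    using eq x by (simp add: point_val_def)
  have "(C1_rep f has_vector_derivative v x) (at x within {0..1})"
    using has_vector_derivative_transform[OF x eq du[OF x]] by blast
  then show "point_deriv f x = v x"
    unfolding point_deriv_def using vector_derivative_within_cbox[of 0 1 x "C1_rep f" "v x"] x by simp
qed

section \<open>Matrices on L2 and the Hermitian inner product\<close>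

lemma bounded_linear_matrix: "bounded_linear (\<lambda>x. (A::complex^2^2) *v x)"
  by (intro linear_conv_bounded_linear[THEN iffD1] linearI)
     (simp_all add: matrix_vector_right_distrib vec_eq_iff matrix_vector_mult_def scaleR_right.sum
       distrib_left sum.distrib)

lemma W22_rep_matrix:
  assumes "W22_rep f u v g"
  shows "W22_rep (l2_matrix A f) (\<lambda>x. A *v u x) (\<lambda>x. A *v v x) (l2_matrix A g)"
  unfolding W22_rep_def represents_rep
proof (intro conjI)
  have u: "AE x in M01. u x = rep_l2 f x" "is_primitive u v" and v: "is_primitive v (rep_l2 g)"
    using assms by (auto simp: W22_rep_def represents_rep)
  show "AE x in M01. A *v u x = rep_l2 (l2_matrix A f) x"
    using u(1) rep_l2_matrix[of A f] by eventually_elim simp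
  show "is_primitive (\<lambda>x. A *v u x) (\<lambda>x. A *v v x)"
    by (rule is_primitive_bounded_linear[OF bounded_linear_matrix u(2)])
  show "is_primitive (\<lambda>x. A *v v x) (rep_l2 (l2_matrix A g))"
  proof (rule is_primitive_cong_AE[OF is_primitive_bounded_linear[OF bounded_linear_matrix v]])
    show "rep_l2 (l2_matrix A g) \<in> borel_measurable M01"
      using integrable_rep_l2 by (rule borel_measurable_integrable)
    show "AE x in M01. A *v rep_l2 g x = rep_l2 (l2_matrix A g) x"
      using rep_l2_matrix[of A g] by eventually_elim simp
  qed
qed

lemma l2_matrix_mult: "l2_matrix A (l2_matrix B f) = l2_matrix (A ** B) f"
proof (rule l2_eqI)
  show "AE x in M01. rep_l2 (l2_matrix A (l2_matrix B f)) x = rep_l2 (l2_matrix (A ** B) f) x"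
    using rep_l2_matrix[of A "l2_matrix B f"] rep_l2_matrix[of B f] rep_l2_matrix[of "A ** B" f]
    by eventually_elim (simp add: matrix_vector_mul_assoc)
qed

lemma l2_matrix_mat_1: "l2_matrix (mat 1) f = f"
  by (rule l2_eqI) (use rep_l2_matrix[of "mat 1" f] in simp)

lemma herm_eq: "herm u v = u $ 1 * cnj (v $ 1) + u $ 2 * cnj (v $ 2)"
  by (simp add: herm_def sum_2)

lemma bounded_bilinear_herm: "bounded_bilinear herm"
  unfolding bilinear_conv_bounded_bilinear[symmetric] bilinear_def
  by (auto intro!: linearI simp: herm_eq algebra_simps scaleR_conv_of_real[where 'a = complex])

lemma herm_adj_mat: "herm (A *v u) v = herm u (adj_mat A *v v)"
  by (simp add: herm_eq adj_mat_def matrix_vector_mult_def sum_2 transpose_def map_matrix_def algebra_simps)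

lemma l2_inner_cong_AE:
  assumes "AE x in M01. f x = rep_l2 f' x" "AE x in M01. g x = rep_l2 g' x"
    and "f \<in> borel_measurable M01" "g \<in> borel_measurable M01"
  shows "l2_inner f' g' = (\<integral>x. herm (f x) (g x) \<partial>M01)"
  unfolding l2_inner_rep
proof (rule integral_cong_AE)
  show "AE x in M01. herm (rep_l2 f' x) (rep_l2 g' x) = herm (f x) (g x)"
    using assms(1,2) by eventually_elim simp
qed (intro measurable_herm assms borel_measurable_integrable integrable_rep_l2)+

lemma l2_inner_l2_matrix: "l2_inner (l2_matrix A f) g = l2_inner f (l2_matrix (adj_mat A) g)"
proof -
  have meas: "(\<lambda>x. B *v rep_l2 h x) \<in> borel_measurable M01" for B :: "complex^2^2" and h
    by (rule borel_measurable_integrable[OF integrable_bounded_linear[OF bounded_linear_matrix integrable_rep_l2]])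
  have AE: "AE x in M01. B *v rep_l2 h x = rep_l2 (l2_matrix B h) x" for B h
    using rep_l2_matrix[of B h] by eventually_elim simp
  have rep: "rep_l2 h \<in> borel_measurable M01" for h
    using integrable_rep_l2 by (rule borel_measurable_integrable)
  have "l2_inner (l2_matrix A f) g = (\<integral>x. herm (A *v rep_l2 f x) (rep_l2 g x) \<partial>M01)"
    by (rule l2_inner_cong_AE[OF AE AE_I2 meas rep]) simp
  also have "\<dots> = (\<integral>x. herm (rep_l2 f x) (adj_mat A *v rep_l2 g x) \<partial>M01)"
    by (simp add: herm_adj_mat)
  also have "\<dots> = l2_inner f (l2_matrix (adj_mat A) g)"
    by (rule l2_inner_cong_AE[OF AE_I2 AE rep meas, symmetric]) simp
  finally show ?thesis .
qed

text \<open>Green's identity. The mixed term pairing \<open>v\<close> with \<open>q\<close> is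
  inserted with both signs, and each half is one integration by parts.\<close>

theorem l2_inner_by_parts:
  assumes f: "W22_rep f u v f2" and g: "W22_rep g p q g2"
  shows "l2_inner f2 g - l2_inner f g2 =
    (herm (v 1) (p 1) - herm (v 0) (p 0)) - (herm (u 1) (q 1) - herm (u 0) (q 0))"
proof -
  have u: "AE x in M01. u x = rep_l2 f x" "is_primitive u v" "is_primitive v (rep_l2 f2)"
    and p: "AE x in M01. p x = rep_l2 g x" "is_primitive p q" "is_primitive q (rep_l2 g2)"
    using f g by (auto simp: W22_rep_def represents_rep)
  have rep: "rep_l2 h \<in> borel_measurable M01" for h
    using integrable_rep_l2 by (rule borel_measurable_integrable)
  have "l2_inner f2 g = (\<integral>x. herm (rep_l2 f2 x) (p x) \<partial>M01)"
    by (rule l2_inner_cong_AE[OF AE_I2 p(1) rep])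
       (auto intro: borel_measurable_integrable continuous_imp_integrable_M01 is_primitive_continuous p)
  moreover have "l2_inner f g2 = (\<integral>x. herm (u x) (rep_l2 g2 x) \<partial>M01)"
    by (rule l2_inner_cong_AE[OF u(1) AE_I2 _ rep])
       (auto intro: borel_measurable_integrable continuous_imp_integrable_M01 is_primitive_continuous u)
  ultimately have "l2_inner f2 g - l2_inner f g2 =
      ((\<integral>x. herm (rep_l2 f2 x) (p x) \<partial>M01) + (\<integral>x. herm (v x) (q x) \<partial>M01)) -
      ((\<integral>x. herm (v x) (q x) \<partial>M01) + (\<integral>x. herm (u x) (rep_l2 g2 x) \<partial>M01))"
    by simp
  then show ?thesis
    unfolding is_primitive_by_parts[OF bounded_bilinear_herm u(3) p(2)]
      is_primitive_by_parts[OF bounded_bilinear_herm u(2) p(3)] .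
qed

section \<open>The adjoint\<close>

lemma W22_rep_in_DomD_iff:
  assumes "W22_rep f u v g"
  shows "f \<in> DomD \<longleftrightarrow> u 0 $ 1 = 0 \<and> u 1 $ 1 = 0 \<and> v 0 $ 2 = 0 \<and> v 1 $ 2 = 0"
  using W22_rep_gen_deriv2(3)[OF assms] W22_rep_point[OF assms] by (simp add: DomD_def)

text \<open>Source of all elements inserted into the adjoint relation: a scalar profile, either a
  test function or a cubic, times a fixed vector.\<close>

lemma W22_rep_scaleR:
  assumes s: "is_primitive s s'" and s': "is_primitive s' s''" and s'': "continuous_on {0..1} s''"
  shows "W22_rep (abs_l2 (\<lambda>x. s x *\<^sub>R e)) (\<lambda>x. s x *\<^sub>R e) (\<lambda>x. s' x *\<^sub>R e) (abs_l2 (\<lambda>x. s'' x *\<^sub>R e))"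
  by (intro W22_rep_abs is_primitive_bounded_linear[OF bounded_linear_scaleR_left] s s'
      continuous_imp_sq_integrable continuous_on_scaleR s'' continuous_on_const)

text \<open>The fixed vector leaves the integral, so a relation valid for every \<open>e\<close>
  becomes an identity of vector integrals.\<close>

lemma l2_inner_scaleR:
  assumes s: "continuous_on {0..1} s"
  shows "l2_inner (abs_l2 (\<lambda>x. s x *\<^sub>R e)) k = herm e (\<integral>x. s x *\<^sub>R rep_l2 k x \<partial>M01)"
proof -
  have se: "continuous_on {0..1} (\<lambda>x. s x *\<^sub>R e)"
    by (intro continuous_on_scaleR s continuous_on_const)
  have "l2_inner (abs_l2 (\<lambda>x. s x *\<^sub>R e)) k = (\<integral>x. herm (s x *\<^sub>R e) (rep_l2 k x) \<partial>M01)"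
  proof (rule l2_inner_cong_AE)
    show "AE x in M01. s x *\<^sub>R e = rep_l2 (abs_l2 (\<lambda>x. s x *\<^sub>R e)) x"
      using rep_abs_l2[OF continuous_imp_sq_integrable[OF se]] by eventually_elim simp
  qed (simp, intro borel_measurable_integrable continuous_imp_integrable_M01 se,
      intro borel_measurable_integrable integrable_rep_l2)
  also have "\<dots> = (\<integral>x. herm e (s x *\<^sub>R rep_l2 k x) \<partial>M01)"
    by (simp only: bounded_bilinear.scaleR_left[OF bounded_bilinear_herm]
        bounded_bilinear.scaleR_right[OF bounded_bilinear_herm])
  also have "\<dots> = herm e (\<integral>x. s x *\<^sub>R rep_l2 k x \<partial>M01)"
    by (rule integral_bounded_linear[OF bounded_bilinear.bounded_linear_right[OF bounded_bilinear_herm]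
          integrable_continuous_scaleR[OF s integrable_rep_l2]])
  finally show ?thesis .
qed

lemma axis_nth_iff: "axis i x $ j = (if j = i then x else 0)"
  by (simp add: axis_def)

lemma herm_axis: "herm (axis 1 1) w = cnj (w $ 1)" "herm (axis 2 1) w = cnj (w $ 2)"
  by (simp_all add: herm_eq axis_def)

lemma herm_ext:
  assumes "\<And>e. herm e v = herm e w"
  shows "v = w"
proof -
  have "v $ 1 = w $ 1" "v $ 2 = w $ 2"
    using assms[of "axis 1 1"] assms[of "axis 2 1"] by (simp_all add: herm_axis)
  then show ?thesis
    by (simp add: vec_eq_iff forall_2)
qed

theorem second_derivative_self_adjoint:
  "(\<forall>f\<in>DomD. l2_inner (gen_deriv2 f) w = l2_inner f k) \<longleftrightarrow> has_gen_deriv2 w k \<and> w \<in> DomD"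
proof
  assume *: "has_gen_deriv2 w k \<and> w \<in> DomD"
  then obtain p q where w: "W22_rep w p q k"
    using has_gen_deriv2_iff by blast
  with * have pq: "p 0 $ 1 = 0" "p 1 $ 1 = 0" "q 0 $ 2 = 0" "q 1 $ 2 = 0"
    using W22_rep_in_DomD_iff by blast+
  show "\<forall>f\<in>DomD. l2_inner (gen_deriv2 f) w = l2_inner f k"
  proof
    fix f assume f: "f \<in> DomD"
    then have "f \<in> W22" by (simp add: DomD_def)
    then obtain u v where u: "W22_rep f u v (gen_deriv2 f)" by (rule W22E)
    with f have "u 0 $ 1 = 0" "u 1 $ 1 = 0" "v 0 $ 2 = 0" "v 1 $ 2 = 0"
      using W22_rep_in_DomD_iff by blast+
    \<comment> \<open>In the boundary form every product contains a vanishing factor: a first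
      component of \<open>p\<close> or \<open>u\<close>, or a second component of \<open>v\<close>
      or \<open>q\<close>.\<close>
    with pq l2_inner_by_parts[OF u w] show "l2_inner (gen_deriv2 f) w = l2_inner f k"
      by (simp add: herm_eq)
  qed
next
  assume *: "\<forall>f\<in>DomD. l2_inner (gen_deriv2 f) w = l2_inner f k"
  have weak: "has_gen_deriv2 w k"
    unfolding has_gen_deriv2_rep
  proof (intro allI impI herm_ext)
    fix \<theta> and e :: "complex^2" assume \<theta>: "test_function \<theta>"
    note \<theta>' = test_function_deriv[OF \<theta>]
    note \<theta>'' = test_function_deriv[OF \<theta>']
    note rep = W22_rep_scaleR[OF test_function_is_primitive[OF \<theta>] test_function_is_primitive[OF \<theta>']
        test_function_continuous[OF \<theta>''], of e]
    have "abs_l2 (\<lambda>x. \<theta> x *\<^sub>R e) \<in> DomD"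
      unfolding W22_rep_in_DomD_iff[OF rep] using test_function_ends[OF \<theta>] test_function_ends[OF \<theta>'] by simp
    then have "l2_inner (gen_deriv2 (abs_l2 (\<lambda>x. \<theta> x *\<^sub>R e))) w = l2_inner (abs_l2 (\<lambda>x. \<theta> x *\<^sub>R e)) k"
      using * by blast
    then show "herm e (\<integral>x. deriv (deriv \<theta>) x *\<^sub>R rep_l2 w x \<partial>M01) = herm e (\<integral>x. \<theta> x *\<^sub>R rep_l2 k x \<partial>M01)"
      by (simp add: W22_rep_gen_deriv2(2)[OF rep] l2_inner_scaleR test_function_continuous \<theta> \<theta>'')
  qed
  then obtain p q where w: "W22_rep w p q k"
    using has_gen_deriv2_iff by blast
  \<comment> \<open>The test element is the cubic s(x) = a + b x + c x^2 + d x^3 times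
    \<open>e\<close>. The coefficients in the formula are s(0) = a, s(1) = a + b + c + d, s'(0) = b
    and s'(1) = b + 2 c + 3 d; the premises say that the element lies in
    \<open>DomD\<close>.\<close>
  have boundary: "((b + 2 * c + 3 * d) *\<^sub>R herm e (p 1) - b *\<^sub>R herm e (p 0)) -
      ((a + b + c + d) *\<^sub>R herm e (q 1) - a *\<^sub>R herm e (q 0)) = 0"
    if e: "a * e $ 1 = 0" "(a + b + c + d) * e $ 1 = 0" "b * e $ 2 = 0" "(b + 2 * c + 3 * d) * e $ 2 = 0"
    for a b c d :: real and e
  proof -
    let ?s = "\<lambda>x. a + b * x + c * x\<^sup>2 + d * x ^ 3" and ?s' = "\<lambda>x. b + 2 * c * x + 3 * d * x\<^sup>2"
    have "(?s has_real_derivative ?s' x) (at x)" "(?s' has_real_derivative 2 * c + 6 * d * x) (at x)" for x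
      by (auto intro!: derivative_eq_intros)
    note ds = this[unfolded has_real_derivative_iff_has_vector_derivative, THEN has_vector_derivative_at_within]
    have cont: "continuous_on {0..1} ?s'" "continuous_on {0..1} (\<lambda>x. 2 * c + 6 * d * x)"
      by (auto intro!: continuous_intros)
    note rep = W22_rep_scaleR[OF is_primitiveI[OF ds(1) cont(1)] is_primitiveI[OF ds(2) cont(2)] cont(2), of e]
    have "abs_l2 (\<lambda>x. ?s x *\<^sub>R e) \<in> DomD"
      unfolding W22_rep_in_DomD_iff[OF rep] using e by (simp add: scaleR_conv_of_real[where 'a = complex])
    then have "l2_inner (gen_deriv2 (abs_l2 (\<lambda>x. ?s x *\<^sub>R e))) w = l2_inner (abs_l2 (\<lambda>x. ?s x *\<^sub>R e)) k"
      using * by blast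
    then show ?thesis
      using l2_inner_by_parts[OF rep w]
      by (simp add: W22_rep_gen_deriv2(2)[OF rep] bounded_bilinear.scaleR_left[OF bounded_bilinear_herm])
  qed
  \<comment> \<open>The variables are instantiated in the order a, e, b, c, d. The profiles are x^2
    - x^3, x - x^2, 3 x^2 - 2 x^3 and 1. The first has only a slope at 1 and the third only a value
    at 1; the second and the fourth then bring in the boundary data at 0.\<close>
  have "cnj (p 1 $ 1) = 0"
    using boundary[of 0 "axis 1 1" 0 1 "-1"] by (simp add: herm_axis axis_nth_iff)
  moreover have "cnj (p 1 $ 1) + cnj (p 0 $ 1) = 0"
    using boundary[of 0 "axis 1 1" 1 "-1" 0] by (simp add: herm_axis axis_nth_iff add_eq_0_iff)
  moreover have "cnj (q 1 $ 2) = 0"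
    using boundary[of 0 "axis 2 1" 0 3 "-2"] by (simp add: herm_axis axis_nth_iff)
  moreover have "cnj (q 1 $ 2) - cnj (q 0 $ 2) = 0"
    using boundary[of 1 "axis 2 1" 0 0 0] by (simp add: herm_axis axis_nth_iff)
  ultimately show "has_gen_deriv2 w k \<and> w \<in> DomD"
    using weak unfolding W22_rep_in_DomD_iff[OF w] by simp
qed

section \<open>The projection attached to the boundary conditions\<close>

lemma herm_matrix_right: "herm u (A *v v) = herm (adj_mat A *v u) v"
  by (simp add: herm_eq adj_mat_def matrix_vector_mult_def sum_2 transpose_def map_matrix_def algebra_simps)

lemma projP_mult: "(projP *v y) $ 1 = y $ 1" "(projP *v y) $ 2 = 0"
  by (simp_all add: projP_def matrix_vector_mult_def sum_2)

lemma mem_herm_compl_ran: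
  "x \<in> herm_compl (ran (A ** projP)) \<longleftrightarrow> (adj_mat A *v x) $ 1 = 0"
  "x \<in> herm_compl (ran (A ** (mat 1 - projP))) \<longleftrightarrow> (adj_mat A *v x) $ 2 = 0"
proof -
  let ?z = "adj_mat A *v x"
  have "x \<in> herm_compl (ran (A ** projP)) \<longleftrightarrow> (\<forall>y::complex^2. ?z $ 1 * cnj (y $ 1) = 0)"
    by (simp add: herm_compl_def ran_def herm_matrix_right[of _ A] projP_mult herm_eq[of ?z]
        flip: matrix_vector_mul_assoc)
  also have "\<dots> \<longleftrightarrow> ?z $ 1 = 0"
    by (auto dest!: spec[of _ "axis 1 1"] simp: axis_def)
  finally show "x \<in> herm_compl (ran (A ** projP)) \<longleftrightarrow> ?z $ 1 = 0" .
  have "x \<in> herm_compl (ran (A ** (mat 1 - projP))) \<longleftrightarrow> (\<forall>y::complex^2. ?z $ 2 * cnj (y $ 2) = 0)"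
    by (simp add: herm_compl_def ran_def herm_matrix_right[of _ A] projP_mult herm_eq[of ?z]
        matrix_vector_mult_diff_rdistrib flip: matrix_vector_mul_assoc)
  also have "\<dots> \<longleftrightarrow> ?z $ 2 = 0"
    by (auto dest!: spec[of _ "axis 2 1"] simp: axis_def)
  finally show "x \<in> herm_compl (ran (A ** (mat 1 - projP))) \<longleftrightarrow> ?z $ 2 = 0" .
qed

lemma adj_mat_mult: "adj_mat (A ** B) = adj_mat B ** adj_mat A"
  by (simp add: adj_mat_def vec_eq_iff matrix_matrix_mult_def transpose_def map_matrix_def mult.commute)

lemma adj_mat_1: "adj_mat (mat 1) = mat 1"
  by (auto simp: adj_mat_def vec_eq_iff mat_def transpose_def map_matrix_def)

lemma adj_mat_uminus: "adj_mat (- A) = - adj_mat A"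
  by (simp add: adj_mat_def vec_eq_iff transpose_def map_matrix_def)

lemma invertible_adj_mat:
  assumes "invertible A"
  obtains C where "C ** adj_mat A = mat 1" "adj_mat A ** C = mat 1"
  using assms that[of "adj_mat _"] unfolding invertible_def by (metis adj_mat_mult adj_mat_1)

lemma rank_column_times_row:
  fixes c r :: "complex^2"
  assumes "c \<noteq> 0" "r \<noteq> 0" and Q: "\<And>i. Q $ i = c $ i *s r"
  shows "rank (Q :: complex^2^2) = 1"
proof -
  obtain i where i: "c $ i \<noteq> 0"
    using assms(1) by (auto simp: vec_eq_iff)
  have "vec.dim (rows Q) = 1"
  proof (rule vec.dim_unique[of "{c $ i *s r}"])
    show "{c $ i *s r} \<subseteq> rows Q"
      by (auto simp: rows_def row_def Q vec_eq_iff)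
    show "rows Q \<subseteq> vec.span {c $ i *s r}"
    proof
      fix x assume "x \<in> rows Q"
      then obtain j where "x = c $ j *s r"
        by (auto simp: rows_def row_def Q vec_eq_iff)
      then have "x = (c $ j / c $ i) *s (c $ i *s r)"
        using i by (simp add: vector_smult_assoc)
      then show "x \<in> vec.span {c $ i *s r}"
        by (metis vec.span_base vec.span_scale singletonI)
    qed
    show "vec.independent {c $ i *s r}"
      using i assms(2) by simp
  qed simp
  then show ?thesis
    by (simp add: row_rank_def_gen)
qed

text \<open>For an idempotent the kernel of \<open>Q\<close> is the range of
  \<open>mat 1 - Q\<close>, and vice versa. The two range conditions thus become the scalar
  equations that define \<open>DomD\<close>, applied to \<open>adj_mat A *v x\<close>.\<close>

lemma is_hat_proj_kernels:
  assumes "is_hat_proj A Q"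
  shows "Q *v x = 0 \<longleftrightarrow> (adj_mat A *v x) $ 1 = 0"
    and "(mat 1 - Q) *v x = 0 \<longleftrightarrow> (adj_mat A *v x) $ 2 = 0"
proof -
  have QQ: "Q ** Q = Q"
    and ran: "ran Q = herm_compl (ran (A ** (mat 1 - projP)))" "ran (mat 1 - Q) = herm_compl (ran (A ** projP))"
    using assms by (auto simp: is_hat_proj_def)
  have "Q *v x = 0 \<longleftrightarrow> x \<in> ran (mat 1 - Q)" for x
  proof
    assume "Q *v x = 0"
    then have "x = (mat 1 - Q) *v x"
      by (simp add: matrix_vector_mult_diff_rdistrib)
    then show "x \<in> ran (mat 1 - Q)"
      by (auto simp: ran_def)
  qed (auto simp: ran_def matrix_vector_mult_diff_rdistrib matrix_vector_mult_diff_distrib matrix_vector_mul_assoc QQ)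
  moreover have "(mat 1 - Q) *v x = 0 \<longleftrightarrow> x \<in> ran Q" for x
  proof
    assume "(mat 1 - Q) *v x = 0"
    then have "x = Q *v x"
      by (simp add: matrix_vector_mult_diff_rdistrib)
    then show "x \<in> ran Q"
      by (auto simp: ran_def)
  qed (auto simp: ran_def matrix_vector_mult_diff_rdistrib matrix_vector_mul_assoc QQ)
  ultimately show "Q *v x = 0 \<longleftrightarrow> (adj_mat A *v x) $ 1 = 0"
    and "(mat 1 - Q) *v x = 0 \<longleftrightarrow> (adj_mat A *v x) $ 2 = 0"
    by (simp_all add: ran mem_herm_compl_ran)
qed

lemma exists_hat_proj:
  assumes "invertible A"
  shows "\<exists>Q. is_hat_proj A Q"
proof -
  obtain C where C: "C ** adj_mat A = mat 1" "adj_mat A ** C = mat 1"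
    using assms by (rule invertible_adj_mat)
  define Q where "Q = C ** projP ** adj_mat A"
  have PP: "projP ** projP = projP"
    by (simp add: matrix_eq vec_eq_iff forall_2 projP_mult flip: matrix_vector_mul_assoc)
  have Qx: "Q *v x = C *v (projP *v (adj_mat A *v x))" for x
    by (simp add: Q_def matrix_vector_mul_assoc matrix_mul_assoc)
  have CA: "C *v (adj_mat A *v x) = x" "adj_mat A *v (C *v x) = x" for x
    by (simp_all add: matrix_vector_mul_assoc C)
  have QQ: "Q ** Q = Q"
    by (simp add: matrix_eq Qx CA matrix_vector_mul_assoc[of projP projP] PP flip: matrix_vector_mul_assoc[of Q Q])
  have r: "x \<in> ran Q \<longleftrightarrow> (adj_mat A *v x) $ 2 = 0" for x
  proof
    assume "x \<in> ran Q"
    then show "(adj_mat A *v x) $ 2 = 0"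
      by (auto simp: ran_def Qx CA projP_mult)
  next
    assume "(adj_mat A *v x) $ 2 = 0"
    then have "projP *v (adj_mat A *v x) = adj_mat A *v x"
      by (simp add: vec_eq_iff forall_2 projP_mult)
    then have "x = Q *v x"
      by (simp add: Qx CA)
    then show "x \<in> ran Q"
      by (auto simp: ran_def)
  qed
  have k: "x \<in> ran (mat 1 - Q) \<longleftrightarrow> (adj_mat A *v x) $ 1 = 0" for x
  proof
    assume "x \<in> ran (mat 1 - Q)"
    then show "(adj_mat A *v x) $ 1 = 0"
      by (auto simp: ran_def Qx CA projP_mult matrix_vector_mult_diff_rdistrib matrix_vector_mult_diff_distrib)
  next
    assume "(adj_mat A *v x) $ 1 = 0"
    then have "projP *v (adj_mat A *v x) = 0"
      by (simp add: vec_eq_iff forall_2 projP_mult)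
    then have "x = (mat 1 - Q) *v x"
      by (simp add: Qx matrix_vector_mult_diff_rdistrib)
    then show "x \<in> ran (mat 1 - Q)"
      by (auto simp: ran_def)
  qed
  \<comment> \<open>\<open>projP\<close> is the outer product of the first unit vector with itself,
    so \<open>Q\<close> is that of the first column of \<open>C\<close> and the first row of
    \<open>adj_mat A\<close>.\<close>
  have "rank Q = 1"
  proof (rule rank_column_times_row)
    show "C *v axis 1 1 \<noteq> 0"
      using CA(2)[of "axis 1 1"] by (metis axis_eq_0_iff matrix_vector_mult_0_right zero_neq_one)
    show "adj_mat A $ 1 \<noteq> 0"
    proof
      assume "adj_mat A $ 1 = 0"
      then have "(adj_mat A *v (C *v axis 1 1)) $ 1 = 0"
        by (simp add: matrix_vector_mult_def)
      then show False
        unfolding CA by (simp add: axis_def)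
    qed
    show "Q $ i = (C *v axis 1 1) $ i *s adj_mat A $ 1" for i
      by (simp add: Q_def projP_def matrix_matrix_mult_def matrix_vector_mult_def vec_eq_iff sum_2 axis_def forall_2)
  qed
  then have "is_hat_proj A Q"
    unfolding is_hat_proj_def using QQ r k by (auto simp: mem_herm_compl_ran)
  then show ?thesis ..
qed

text \<open>Both projections have the same kernel and the same fixed vectors. In the splitting of
  \<open>x\<close> into \<open>Q *v x\<close> and \<open>x - Q *v x\<close>, therefore,
  \<open>R\<close> fixes the first part and kills the second.\<close>

lemma hat_proj_unique:
  assumes "is_hat_proj A Q" "is_hat_proj A R"
  shows "Q = R"
proof -
  have QQ: "Q ** Q = Q"
    using assms by (auto simp: is_hat_proj_def)
  then have QQx: "Q *v (Q *v x) = Q *v x" for x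
    by (simp add: matrix_vector_mul_assoc)
  have "Q *v x = R *v x" for x
  proof -
    have "Q *v (x - Q *v x) = 0" "(mat 1 - Q) *v (Q *v x) = 0"
      by (simp_all add: matrix_vector_mult_diff_distrib matrix_vector_mult_diff_rdistrib QQx)
    then have "R *v (x - Q *v x) = 0" "(mat 1 - R) *v (Q *v x) = 0"
      using is_hat_proj_kernels[OF assms(1)] is_hat_proj_kernels[OF assms(2)] by blast+
    then show ?thesis
      by (simp add: matrix_vector_mult_diff_distrib matrix_vector_mult_diff_rdistrib)
  qed
  then show ?thesis
    by (simp add: matrix_eq)
qed

section \<open>Domain and values of the adjoint\<close>

lemma adjoint_domain_iff:
  assumes A: "invertible A" and Q: "is_hat_proj A Q"
  shows "l2_matrix (- adj_mat A) g \<in> DomD \<longleftrightarrow>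
    g \<in> W22 \<and> Q *v point_val g 0 = 0 \<and> Q *v point_val g 1 = 0 \<and>
      (mat 1 - Q) *v point_deriv g 0 = 0 \<and> (mat 1 - Q) *v point_deriv g 1 = 0"
proof (cases "g \<in> W22")
  case True
  then obtain u v where u: "W22_rep g u v (gen_deriv2 g)" by (rule W22E)
  have neg: "(- adj_mat A) *v x = - (adj_mat A *v x)" for x
    by (simp add: matrix_vector_mult_def vec_eq_iff sum_negf)
  show ?thesis
    using True W22_rep_point[OF u]
    by (simp add: W22_rep_in_DomD_iff[OF W22_rep_matrix[OF u]] neg is_hat_proj_kernels[OF Q])
next
  \<comment> \<open>Both sides must fail here: multiplying by \<open>- C\<close>, the inverse of
    \<open>- adj_mat A\<close>, would carry membership in \<open>W22\<close> from the transformed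
    element back to \<open>g\<close>.\<close>
  case False
  obtain C where C: "C ** adj_mat A = mat 1"
    using A by (rule invertible_adj_mat)
  have "l2_matrix (- adj_mat A) g \<notin> W22"
  proof
    assume "l2_matrix (- adj_mat A) g \<in> W22"
    then obtain u v where "W22_rep (l2_matrix (- adj_mat A) g) u v (gen_deriv2 (l2_matrix (- adj_mat A) g))"
      by (rule W22E)
    from W22_rep_gen_deriv2(3)[OF W22_rep_matrix[OF this, of "- C"]]
    have "l2_matrix ((- C) ** (- adj_mat A)) g \<in> W22"
      by (simp add: l2_matrix_mult)
    moreover have "(- C) ** (- adj_mat A) = mat 1"
      by (simp add: C[symmetric] matrix_matrix_mult_def vec_eq_iff)
    ultimately show False
      using False by (simp add: l2_matrix_mat_1)
  qed
  then show ?thesis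
    using False by (simp add: DomD_def)
qed

lemma adjoint_relation_iff:
  "(\<forall>f\<in>dom (opAD A). l2_inner (the (opAD A f)) g = l2_inner f h) \<longleftrightarrow>
    has_gen_deriv2 (l2_matrix (- adj_mat A) g) h \<and> l2_matrix (- adj_mat A) g \<in> DomD"
proof -
  have "(\<forall>f\<in>dom (opAD A). l2_inner (the (opAD A f)) g = l2_inner f h) \<longleftrightarrow>
      (\<forall>f\<in>DomD. l2_inner (gen_deriv2 f) (l2_matrix (- adj_mat A) g) = l2_inner f h)"
    by (auto simp: opAD_def dom_def restrict_map_def l2_inner_l2_matrix adj_mat_uminus)
  then show ?thesis
    by (simp add: second_derivative_self_adjoint)
qed

theorem lemma2:
  fixes A :: "complex^2^2"
  assumes "invertible A"
  shows "(\<exists>!Q. is_hat_proj A Q) \<and>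
    (\<forall>Q. is_hat_proj A Q \<longrightarrow>
       op_adjoint (opAD A) =
         (\<lambda>f. Some (l2_matrix (- adj_mat A) (gen_deriv2 f))) |`
           {f \<in> W22. Q *v point_val f 0 = 0 \<and> Q *v point_val f 1 = 0 \<and>
                     (mat 1 - Q) *v point_deriv f 0 = 0 \<and>
                     (mat 1 - Q) *v point_deriv f 1 = 0})"
proof (intro conjI allI impI ext)
  show "\<exists>!Q. is_hat_proj A Q"
    using exists_hat_proj[OF assms] hat_proj_unique by blast
next
  fix Q g assume Q: "is_hat_proj A Q"
  let ?w = "l2_matrix (- adj_mat A) g"
  let ?S = "{f \<in> W22. Q *v point_val f 0 = 0 \<and> Q *v point_val f 1 = 0 \<and>
    (mat 1 - Q) *v point_deriv f 0 = 0 \<and> (mat 1 - Q) *v point_deriv f 1 = 0}"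
  have dom: "?w \<in> DomD \<longleftrightarrow> g \<in> ?S"
    using adjoint_domain_iff[OF assms Q] by simp
  show "op_adjoint (opAD A) g = ((\<lambda>f. Some (l2_matrix (- adj_mat A) (gen_deriv2 f))) |` ?S) g"
  proof (cases "g \<in> ?S")
    case True
    then have "g \<in> W22" by simp
    then obtain u v where "W22_rep g u v (gen_deriv2 g)" by (rule W22E)
    from W22_rep_gen_deriv2(1)[OF W22_rep_matrix[OF this]]
    \<comment> \<open>The weak second derivative commutes with the constant matrix and is unique, so
      exactly one \<open>h\<close> satisfies the adjoint relation and the description in
      \<open>op_adjoint\<close> evaluates to it.\<close>
    have "has_gen_deriv2 ?w h \<longleftrightarrow> h = l2_matrix (- adj_mat A) (gen_deriv2 g)" for h
      using has_gen_deriv2_unique by blast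
    with True dom show ?thesis
      by (simp add: op_adjoint_def adjoint_relation_iff del: mem_Collect_eq)
  next
    \<comment> \<open>No \<open>h\<close> satisfies the adjoint relation, since that would put
      \<open>?w\<close> into \<open>DomD\<close>; both partial maps are undefined at
      \<open>g\<close>.\<close>
    case False
    with dom show ?thesis
      by (simp add: op_adjoint_def adjoint_relation_iff del: mem_Collect_eq)
  qed
qed

end
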